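(* Let $\psi\in C^1$ and $\phi\in C^3$. Let $x_0$ be a nondegenerate $T$-periodic limit cycle of $\dot x=\psi(x)$. Assume that for some $\theta_0\in[0,T]$ we have $$f_{x_0}(\theta_0)=f_{x_0}'(\theta_0)=f_{x_0}''(\theta_0)=0,\qquad f_{x_0}'''(\theta_0)\neq0.$$ Then for all $\varepsilon>0$ sufficiently small the system $\dot x=\psi(x)+\varepsilon\phi(t,x,\varepsilon)$ has a $T$-periodic solution $x_\varepsilon$ satisfying $$x_\varepsilon(t)\to x_0(t+\theta_0)\quad\text{as }\varepsilon\to0,\qquad t\in[0,T].$$
   Context: Fix $T>0$ and $n\in\mathbb{N}$; $\psi:\mathbb{R}^n\to\mathbb{R}^n$, and $\phi:\mathbb{R}\times\mathbb{R}^n\times[0,1]\to\mathbb{R}^n$ is $T$-periodic in its first variable. A $T$-periodic solution is a solution $x\in C([0,T],\mathbb{R}^n)$ with $x(0)=x(T)$, extended to $\mathbb{R}$ by $T$-periodicity. A nondegenerate $T$-periodic limit cycle of $\dot x=\psi(x)$ is a nonconstant $T$-periodic solution $x_0$ such that the linearized $T$-periodic system $\dot y=\psi'(x_0(t))y$ has the characteristic (Floquet) multiplier $1$ with multiplicity $1$. The Malkin bifurcation function is $$f_{x_0}(\theta)=\mathrm{sign}\langle\dot x_0(0),z_0(0)\rangle\int_0^T\langle z_0(\tau),\phi(\tau-\theta,x_0(\tau),0)\rangle d\tau,$$ where $z_0$ is a nontrivial $T$-periodic solution of the adjoint system $\dot z=-(\psi'(x_0(t)))^*z$; it is defined for all $\theta\in\mathbb{R}$.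 *)

theory Defs
  imports "HOL-Analysis.Analysis" "HOL-Computational_Algebra.Polynomial"
begin

text \<open>
  Class \<open>C\<^sup>k\<close> on a set \<open>S\<close>, which may contain boundary points (there the derivatives are taken
  within \<open>S\<close>). Requiring each directional derivative \<open>x \<mapsto> f' x v\<close> to be of class
  \<open>C\<^sup>k\<^sup>-\<^sup>1\<close> is the usual condition on \<open>f'\<close>, the domain being finite-dimensional.
\<close>

primrec C_on :: "nat \<Rightarrow> 'a::euclidean_space set \<Rightarrow> ('a \<Rightarrow> 'b::real_normed_vector) \<Rightarrow> bool" where
  "C_on 0 S f \<longleftrightarrow> continuous_on S f"
| "C_on (Suc k) S f \<longleftrightarrow>
     (\<exists>f'. (\<forall>x\<in>S. (f has_derivative f' x) (at x within S)) \<and> (\<forall>v. C_on k S (\<lambda>x. f' x v)))"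

text \<open>
  A solution on \<open>[0,T]\<close> with equal end values, extended to the whole line by \<open>T\<close>-periodicity.
\<close>

definition periodic_solution ::
    "real \<Rightarrow> (real \<Rightarrow> real ^ 'n \<Rightarrow> real ^ 'n) \<Rightarrow> (real \<Rightarrow> real ^ 'n) \<Rightarrow> bool" where
  "periodic_solution T F x \<longleftrightarrow>
     (\<forall>t\<in>{0..T}. (x has_vector_derivative F t (x t)) (at t within {0..T})) \<and>
     x 0 = x T \<and> (\<forall>t. x (t + T) = x t)"

definition charpoly :: "real ^ 'n ^ 'n \<Rightarrow> real poly" where
  "charpoly M = det (mat [:0, 1:] - (\<chi> i j. [:M $ i $ j:]))"

definition monodromy_matrix :: "real \<Rightarrow> (real \<Rightarrow> real ^ 'n ^ 'n) \<Rightarrow> real ^ 'n ^ 'n \<Rightarrow> bool" where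
  "monodromy_matrix T A M \<longleftrightarrow>
     (\<exists>Y. (\<forall>t\<in>{0..T}. (Y has_vector_derivative A t ** Y t) (at t within {0..T})) \<and>
          Y 0 = mat 1 \<and> Y T = M)"

text \<open>
  The multiplicity of a Floquet multiplier is its algebraic multiplicity as an eigenvalue of the
  monodromy matrix. Only real multipliers are needed, for which it does not matter that the
  characteristic polynomial is taken over the reals.
\<close>

definition floquet_multiplier ::
    "real \<Rightarrow> (real \<Rightarrow> real ^ 'n ^ 'n) \<Rightarrow> real \<Rightarrow> nat \<Rightarrow> bool" where
  "floquet_multiplier T A \<mu> m \<longleftrightarrow>
     m \<ge> 1 \<and> (\<exists>M. monodromy_matrix T A M \<and> order \<mu> (charpoly M) = m)"

definition nondegenerate_limit_cycle ::
    "real \<Rightarrow> (real ^ 'n \<Rightarrow> real ^ 'n) \<Rightarrow> (real \<Rightarrow> real ^ 'n) \<Rightarrow> bool" where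
  "nondegenerate_limit_cycle T \<psi> x0 \<longleftrightarrow>
     periodic_solution T (\<lambda>t. \<psi>) x0 \<and> \<not> x0 constant_on UNIV \<and>
     floquet_multiplier T (\<lambda>t. jacobian \<psi> (at (x0 t))) 1 1"

definition adjoint_solution ::
    "real \<Rightarrow> (real ^ 'n \<Rightarrow> real ^ 'n) \<Rightarrow> (real \<Rightarrow> real ^ 'n) \<Rightarrow> (real \<Rightarrow> real ^ 'n) \<Rightarrow> bool" where
  "adjoint_solution T \<psi> x0 z0 \<longleftrightarrow>
     periodic_solution T (\<lambda>t z. - (transpose (jacobian \<psi> (at (x0 t))) *v z)) z0 \<and>
     (\<exists>t. z0 t \<noteq> 0)"

text \<open>
  The function depends on the chosen adjoint solution \<open>z0\<close> only through a positive factor.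
\<close>

definition malkin ::
    "real \<Rightarrow> (real \<Rightarrow> real ^ 'n \<Rightarrow> real \<Rightarrow> real ^ 'n) \<Rightarrow> (real \<Rightarrow> real ^ 'n) \<Rightarrow> (real \<Rightarrow> real ^ 'n)
      \<Rightarrow> real \<Rightarrow> real" where
  "malkin T \<phi> x0 z0 \<theta> =
     sgn (vector_derivative x0 (at 0) \<bullet> z0 0) *
     integral {0..T} (\<lambda>\<tau>. z0 \<tau> \<bullet> \<phi> (\<tau> - \<theta>) (x0 \<tau>) 0)"

end

theory Submission imports Defs begin

text \<open>
  Periodic solutions are sought in the form \<open>x(t) = x\<^sub>0(t + \<theta>) + \<epsilon> u(t + \<theta>)\<close>. In the time
  \<open>\<tau> = t + \<theta>\<close> the function \<open>u\<close> obeys on \<open>[0,T]\<close> the equation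
  \<open>u' = (\<psi>(x\<^sub>0 + \<epsilon> u) - \<psi>(x\<^sub>0)) / \<epsilon> + \<phi>(\<tau> - \<theta>, x\<^sub>0 + \<epsilon> u, \<epsilon>)\<close>, whose right-hand side extends
  continuously to \<open>\<epsilon> = 0\<close>, where it is the linear equation
  \<open>u' = \<psi>'(x\<^sub>0) u + \<phi>(\<tau> - \<theta>, x\<^sub>0, 0)\<close>. The Picard fixed point depends continuously on all
  parameters (\<open>parametrized_flow\<close>, \<open>rescaled_flow\<close>), and zeros of \<open>G \<epsilon> \<theta> w = u(T) - w\<close>,
  where \<open>u(0) = w\<close>, yield periodic solutions as long as \<open>\<epsilon> u\<close> stays small.

  At \<open>\<epsilon> = 0\<close> the map is affine in \<open>w\<close>: \<open>G 0 \<theta> w = (M - 1) w + c(\<theta>)\<close> with the monodromy matrix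
  \<open>M\<close>. Put \<open>\<zeta> = z\<^sub>0(0)\<close>. Pairing with the adjoint solution shows that \<open>\<zeta>\<close> is orthogonal to the
  range of \<open>M - 1\<close> and that \<open>\<langle>\<zeta>, c(\<theta>)\<rangle>\<close> is the Malkin integral (\<open>adjoint_pairing\<close>). The kernel of
  \<open>M - 1\<close> is spanned by the velocity of the cycle at time \<open>0\<close>, because the multiplier \<open>1\<close> is simple
  (\<open>eigenspace_of_simple_root\<close>), and this velocity is not orthogonal to \<open>\<zeta>\<close>: otherwise the sign
  factor, and with it the bifurcation function and its third derivative, would vanish. Hence \<open>M - 1\<close>
  is injective on the orthogonal complement of \<open>\<zeta>\<close>.

  So the limit problem splits into the scalar equation \<open>\<langle>\<zeta>, c(\<theta>)\<rangle> = 0\<close> and a linear equation for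
  \<open>w\<close> that is uniquely solvable in this complement. The left side of the scalar equation changes sign at \<open>\<theta>\<^sub>0\<close>, a zero
  of order three (\<open>third_order_zero_sign\<close>). A sign change in one direction and an invertible linear
  map in the others survive small continuous perturbations by Brouwer's theorem
  (\<open>reduced_equation_has_zeros\<close>), so for every \<open>\<delta> > 0\<close> and all small \<open>\<epsilon> > 0\<close> there is a zero with
  \<open>|\<theta> - \<theta>\<^sub>0| < \<delta>\<close> and with \<open>w\<close> in a fixed ball. Since \<open>u\<close> is then bounded uniformly, \<open>x\<close> is close to
  \<open>x\<^sub>0(\<cdot> + \<theta>\<^sub>0)\<close>.
\<close>

section \<open>Consequences of continuous differentiability\<close>

lemma C_on_imp_continuous_on: "C_on k S f \<Longrightarrow> continuous_on S f"
  by (cases k) (auto intro: has_derivative_continuous_on)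

text \<open>
  The mean value inequality; continuity of the finitely many directional derivatives
  \<open>f' x b\<close> along basis vectors bounds the operator norm of \<open>f' x\<close> on the compact set.
\<close>

lemma lipschitz_on_compact_convex:
  fixes f :: "'a::euclidean_space \<Rightarrow> 'b::real_normed_vector"
  assumes der: "\<And>x. x \<in> S \<Longrightarrow> (f has_derivative f' x) (at x within S)"
    and cont: "\<And>v. continuous_on S (\<lambda>x. f' x v)"
    and C: "compact C" "convex C" "C \<subseteq> S"
  obtains L where "L > 0" and "\<And>x v. x \<in> C \<Longrightarrow> norm (f' x v) \<le> L * norm v"
    and "\<And>x y. x \<in> C \<Longrightarrow> y \<in> C \<Longrightarrow> norm (f x - f y) \<le> L * norm (x - y)"
proof -
  have "continuous_on C (\<lambda>x. \<Sum>b\<in>Basis. norm (f' x b))"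
    using cont C(3) by (intro continuous_intros) (auto intro: continuous_on_subset)
  then have "bounded ((\<lambda>x. \<Sum>b\<in>Basis. norm (f' x b)) ` C)"
    using C(1) by (simp add: compact_continuous_image compact_imp_bounded)
  then obtain L where L: "L > 0" "\<And>x. x \<in> C \<Longrightarrow> norm (\<Sum>b\<in>Basis. norm (f' x b)) \<le> L"
    unfolding bounded_pos by auto
  have bl: "bounded_linear (f' x)" if "x \<in> C" for x
    using der that C(3) has_derivative_bounded_linear by blast
  have on: "onorm (f' x) \<le> L" if "x \<in> C" for x
  proof -
    have "onorm (f' x) \<le> (\<Sum>b\<in>Basis. norm (f' x b))"
      using bl[OF that] by (rule onorm_componentwise)
    also have "\<dots> \<le> L"
      using L(2)[OF that] by (simp add: sum_nonneg)
    finally show ?thesis .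
  qed
  show thesis
  proof
    show "L > 0" by fact
    show "norm (f' x v) \<le> L * norm v" if "x \<in> C" for x v
      by (rule order_trans[OF onorm[OF bl[OF that]]]) (simp add: mult_right_mono on that)
    show "norm (f x - f y) \<le> L * norm (x - y)" if "x \<in> C" "y \<in> C" for x y
      using differentiable_bound[OF C(2), of f f' L] der C(3) on that
      by (meson has_derivative_subset subset_iff)
  qed
qed

text \<open>
  The mean value inequality for \<open>f - f' a\<close>, whose derivative is small near \<open>a\<close>. The estimate is
  uniform in both end points, as the limit of difference quotients with moving base point requires.
\<close>

lemma strictly_differentiable:
  fixes f :: "'a::euclidean_space \<Rightarrow> 'b::real_normed_vector"
  assumes der: "\<And>x. (f has_derivative f' x) (at x)"
    and cont: "\<And>v. continuous_on UNIV (\<lambda>x. f' x v)"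
    and e: "e > 0"
  obtains d where "d > 0"
    and "\<And>y v. y \<in> ball a d \<Longrightarrow> norm (f' y v - f' a v) \<le> e * norm v"
    and "\<And>x y. x \<in> ball a d \<Longrightarrow> y \<in> ball a d \<Longrightarrow> norm (f x - f y - f' a (x - y)) \<le> e * norm (x - y)"
proof -
  have bl: "bounded_linear (f' x)" for x
    using der has_derivative_bounded_linear by blast
  define N where "N x = (\<Sum>b\<in>Basis. norm (f' x b - f' a b))" for x
  have "continuous_on UNIV N"
    unfolding N_def using cont by (intro continuous_intros) auto
  then have "isCont N a"
    by (simp add: continuous_on_eq_continuous_at)
  then obtain d where d: "d > 0" "\<And>x. dist x a < d \<Longrightarrow> dist (N x) (N a) < e"
    using e unfolding continuous_at_eps_delta by (auto simp: dist_real_def)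
  have on: "onorm (\<lambda>v. f' x v - f' a v) \<le> e" if "x \<in> ball a d" for x
  proof -
    have "onorm (\<lambda>v. f' x v - f' a v) \<le> N x"
      unfolding N_def by (intro onorm_componentwise bounded_linear_sub bl)
    also have "N x \<le> dist (N x) (N a)"
      by (simp add: N_def)
    finally show ?thesis
      using d(2)[of x] that by (auto simp: dist_commute)
  qed
  have n: "norm (f' y v - f' a v) \<le> e * norm v" if "y \<in> ball a d" for y v
    by (rule order_trans[OF onorm[OF bounded_linear_sub[OF bl bl]]]) (intro mult_right_mono on that norm_ge_zero)
  show thesis
  proof
    show "norm (f x - f y - f' a (x - y)) \<le> e * norm (x - y)" if "x \<in> ball a d" "y \<in> ball a d" for x y
    proof -
      have "norm ((f x - f' a x) - (f y - f' a y)) \<le> e * norm (x - y)"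
      proof (rule differentiable_bound[of "ball a d" "\<lambda>x. f x - f' a x" "\<lambda>x v. f' x v - f' a v"])
        show "((\<lambda>x. f x - f' a x) has_derivative (\<lambda>v. f' x v - f' a v)) (at x within ball a d)" for x
          by (intro has_derivative_diff has_derivative_at_withinI[OF der] bounded_linear_imp_has_derivative bl)
      qed (use that on in auto)
      then show ?thesis
        by (subst linear_diff[OF bounded_linear.linear[OF bl]]) (simp add: algebra_simps)
    qed
  qed (use d n in auto)
qed

text \<open>
  The first term of the rescaled equation. The map \<open>r\<close> stands for a cut-off, which will make the
  equation globally Lipschitz; it is invisible near \<open>\<epsilon> = 0\<close>, because \<open>\<epsilon> u\<close> is then short.
\<close>

lemma difference_quotient_continuous:
  fixes \<psi> :: "'a::euclidean_space \<Rightarrow> 'b::real_normed_vector" and x :: "real \<Rightarrow> 'a"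
  assumes der: "\<And>y. (\<psi> has_derivative D y) (at y)"
    and contD: "\<And>v. continuous_on UNIV (\<lambda>y. D y v)"
    and x: "continuous_on A x"
    and r: "continuous_on UNIV r" "\<And>v. norm v \<le> 1 \<Longrightarrow> r v = v"
  shows "continuous_on ({0..1} \<times> A \<times> UNIV) (\<lambda>(\<epsilon>, t, u).
    if \<epsilon> = 0 then D (x t) u else (1 / \<epsilon>) *\<^sub>R (\<psi> (x t + r (\<epsilon> *\<^sub>R u)) - \<psi> (x t)))"
    (is "continuous_on ?S (\<lambda>(\<epsilon>, t, u). ?q \<epsilon> t u)")
  unfolding continuous_on_eq_continuous_within
proof safe
  fix \<epsilon>0 :: real and t0 :: real and u0 :: 'a
  assume \<epsilon>0: "\<epsilon>0 \<in> {0..1}" and t0: "t0 \<in> A"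
  have cont\<psi>: "continuous_on UNIV \<psi>"
    using der by (auto intro: has_derivative_continuous_on has_derivative_at_withinI)
  let ?p = "(\<epsilon>0, t0, u0)"
  show "continuous (at ?p within ?S) (\<lambda>(\<epsilon>, t, u). ?q \<epsilon> t u)"
  proof (cases "\<epsilon>0 = 0")
    case False
    let ?S' = "{0<..1} \<times> A \<times> (UNIV :: 'a set)"
    have "continuous_on ?S' (\<lambda>p. (1 / fst p) *\<^sub>R (\<psi> (x (fst (snd p)) + r (fst p *\<^sub>R snd (snd p))) - \<psi> (x (fst (snd p)))))"
      by (intro continuous_intros continuous_on_compose2[OF cont\<psi>] continuous_on_compose2[OF r(1)]
          continuous_on_compose2[OF x]) auto
    then have "continuous_on ?S' (\<lambda>(\<epsilon>, t, u). ?q \<epsilon> t u)"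
      by (rule continuous_on_eq) auto
    then have "continuous (at ?p within ?S') (\<lambda>(\<epsilon>, t, u). ?q \<epsilon> t u)"
      using False \<epsilon>0 t0 by (auto simp: continuous_on_eq_continuous_within)
    moreover have "at ?p within ?S' = at ?p within ?S"
      by (rule at_within_nhd[of _ "{0<..} \<times> UNIV"]) (use False \<epsilon>0 in \<open>auto intro!: open_Times\<close>)
    ultimately show ?thesis
      by simp
  next
    case True
    let ?F = "at ?p within ?S"
    let ?a = "x t0"
    have linD: "linear (D y)" for y
      using der has_derivative_linear by blast
    have lim_\<epsilon>: "((\<lambda>p. fst p) \<longlongrightarrow> \<epsilon>0) ?F" and lim_t: "((\<lambda>p. fst (snd p)) \<longlongrightarrow> t0) ?F"
      and lim_u: "((\<lambda>p. snd (snd p)) \<longlongrightarrow> u0) ?F"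
      by (auto intro!: tendsto_eq_intros)
    have lim_x: "((\<lambda>p. x (fst (snd p))) \<longlongrightarrow> ?a) ?F"
    proof -
      have "continuous_on ?S (\<lambda>p. x (fst (snd p)))"
        by (intro continuous_on_compose2[OF x] continuous_intros) auto
      then show ?thesis
        using \<epsilon>0 t0 by (auto simp: continuous_on_def)
    qed
    have lim_\<epsilon>u: "((\<lambda>p. fst p *\<^sub>R snd (snd p)) \<longlongrightarrow> 0) ?F"
      using tendsto_scaleR[OF lim_\<epsilon> lim_u] True by simp
    have "((\<lambda>p. (case p of (\<epsilon>, t, u) \<Rightarrow> ?q \<epsilon> t u) - D ?a (snd (snd p))) \<longlongrightarrow> 0) ?F"
    proof (rule tendstoI)
      fix e :: real assume e: "e > 0"
      define e' where "e' = e / (norm u0 + 2)"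
      have e': "e' > 0" "e' * (norm u0 + 1) < e"
      proof -
        have n: "norm u0 + 2 > 0"
          by (simp add: add_nonneg_pos)
        then show "e' > 0"
          using e by (simp add: e'_def)
        then have "e' * (norm u0 + 1) < e' * (norm u0 + 2)"
          by simp
        also have "\<dots> = e"
          using n by (simp add: e'_def)
        finally show "e' * (norm u0 + 1) < e" .
      qed
      \<comment> \<open>Strict differentiability at \<open>x t0\<close> handles the moving base point \<open>x t\<close> and the step
        \<open>\<epsilon> u\<close> at the same time.\<close>
      obtain d where d: "d > 0"
        "\<And>y v. y \<in> ball ?a d \<Longrightarrow> norm (D y v - D ?a v) \<le> e' * norm v"
        "\<And>y1 y2. y1 \<in> ball ?a d \<Longrightarrow> y2 \<in> ball ?a d \<Longrightarrow> norm (\<psi> y1 - \<psi> y2 - D ?a (y1 - y2)) \<le> e' * norm (y1 - y2)"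
        using strictly_differentiable[OF der contD e'(1)] by blast
      have "\<forall>\<^sub>F p in ?F. dist (x (fst (snd p))) ?a < d"
        using lim_x d(1) by (rule tendstoD)
      moreover have "\<forall>\<^sub>F p in ?F. dist (x (fst (snd p)) + fst p *\<^sub>R snd (snd p)) ?a < d"
        using tendsto_add[OF lim_x lim_\<epsilon>u] d(1) by (intro tendstoD) simp_all
      moreover have "\<forall>\<^sub>F p in ?F. dist (fst p *\<^sub>R snd (snd p)) 0 < 1"
        using lim_\<epsilon>u by (rule tendstoD) simp
      moreover have "\<forall>\<^sub>F p in ?F. dist (snd (snd p)) u0 < 1"
        using lim_u by (rule tendstoD) simp
      moreover have "\<forall>\<^sub>F p in ?F. p \<in> ?S"
        by (simp add: eventually_at_filter)
      ultimately show "\<forall>\<^sub>F p in ?F. dist ((case p of (\<epsilon>, t, u) \<Rightarrow> ?q \<epsilon> t u) - D ?a (snd (snd p))) 0 < e"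
      proof eventually_elim
        case (elim p)
        obtain \<epsilon> t u where [simp]: "p = (\<epsilon>, t, u)"
          by (cases p)
        have "norm (?q \<epsilon> t u - D ?a u) \<le> e' * norm u"
        proof (cases "\<epsilon> = 0")
          case True
          then show ?thesis
            using d(2)[of "x t" u] elim by (simp add: dist_commute)
        next
          case False
          have "?q \<epsilon> t u - D ?a u = (1 / \<epsilon>) *\<^sub>R (\<psi> (x t + \<epsilon> *\<^sub>R u) - \<psi> (x t) - D ?a (\<epsilon> *\<^sub>R u))"
            using False elim by (simp add: r(2) linear_cmul[OF linD] scaleR_diff_right)
          also have "norm \<dots> \<le> (1 / \<bar>\<epsilon>\<bar>) * (e' * norm (\<epsilon> *\<^sub>R u))"
          proof -
            have "norm (\<psi> (x t + \<epsilon> *\<^sub>R u) - \<psi> (x t) - D ?a (\<epsilon> *\<^sub>R u)) \<le> e' * norm (\<epsilon> *\<^sub>R u)"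
              using d(3)[of "x t + \<epsilon> *\<^sub>R u" "x t"] elim by (simp add: dist_commute)
            from mult_left_mono[OF this, of "1 / \<bar>\<epsilon>\<bar>"] show ?thesis
              by simp
          qed
          also have "\<dots> = e' * norm u"
            using False by simp
          finally show ?thesis .
        qed
        also have "\<dots> \<le> e' * (norm u0 + 1)"
          using elim e'(1) norm_triangle_ineq2[of u u0] by (intro mult_left_mono) (auto simp: dist_norm)
        finally show ?case
          using e'(2) by simp
      qed
    qed
    moreover have "((\<lambda>p. D ?a (snd (snd p))) \<longlongrightarrow> D ?a u0) ?F"
      using linear_continuous_at[of "D ?a" u0] linD lim_u
      by (intro isCont_tendsto_compose[of _ "D ?a"]) (auto simp: linear_conv_bounded_linear)
    ultimately have "((\<lambda>p. (case p of (\<epsilon>, t, u) \<Rightarrow> ?q \<epsilon> t u) - D ?a (snd (snd p)) + D ?a (snd (snd p))) \<longlongrightarrow> 0 + D ?a u0) ?F"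
      by (rule tendsto_add)
    then show ?thesis
      using True by (simp add: continuous_within)
  qed
qed

section \<open>Differential equations with parameters\<close>

text \<open>
  Picard's theorem for globally Lipschitz equations, obtained on all of \<open>[0,T]\<close> at once from one
  application of Banach's theorem: the unknown is \<open>v(t) = exp(-kt) u(t)\<close>, and for \<open>k \<ge> 2 L\<close>
  the integral operator contracts the supremum norm by \<open>1/2\<close>. As this rate is the same for all
  parameters, the fixed points depend continuously on them whenever the operators do pointwise.
\<close>

lemma parametrized_flow:
  fixes g :: "'p::metric_space \<Rightarrow> real \<Rightarrow> 'a::euclidean_space \<Rightarrow> 'a"
  assumes T: "T > 0"
    and cont: "continuous_on (P \<times> {0..T} \<times> UNIV) (\<lambda>(p, t, u). g p t u)"
    and lip: "\<And>p t u v. p \<in> P \<Longrightarrow> t \<in> {0..T} \<Longrightarrow> norm (g p t u - g p t v) \<le> L * norm (u - v)"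
  obtains X where "\<And>p w. p \<in> P \<Longrightarrow> X p w 0 = w"
    and "\<And>p w t. p \<in> P \<Longrightarrow> t \<in> {0..T} \<Longrightarrow>
           (X p w has_vector_derivative g p t (X p w t)) (at t within {0..T})"
    and "continuous_on (P \<times> UNIV \<times> {0..T}) (\<lambda>(p, w, t). X p w t)"
proof -
  define k where "k = 2 * \<bar>L\<bar> + 1"
  have k: "k > 0" "2 * \<bar>L\<bar> \<le> k"
    by (auto simp: k_def)
  \<comment> \<open>Bounded continuous functions live on the whole line, so functions on \<open>[0,T]\<close> are
    extended by constants outside.\<close>
  define r where "r t = max 0 (min T t)" for t
  have r: "r t \<in> {0..T}" "t \<in> {0..T} \<Longrightarrow> r t = t" for t
    using T by (auto simp: r_def)
  have contr: "continuous_on S r" for S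
    unfolding r_def by (intro continuous_intros)
  define J where "J p v t = integral {0..t} (\<lambda>s. g p s (exp (k * s) *\<^sub>R apply_bcontfun v s))"
    for p and v :: "real \<Rightarrow>\<^sub>C 'a" and t
  have contg: "continuous_on {0..T} (\<lambda>s. g p s (exp (k * s) *\<^sub>R apply_bcontfun v s))"
    if "p \<in> P" for p v
  proof -
    have "continuous_on {0..T} (\<lambda>s. (p, s, exp (k * s) *\<^sub>R apply_bcontfun v s))"
      by (intro continuous_intros continuous_on_apply_bcontfun)
    from continuous_on_compose2[OF cont this] show ?thesis
      using that by auto
  qed
  have intg: "(\<lambda>s. g p s (exp (k * s) *\<^sub>R apply_bcontfun v s)) integrable_on {0..t}"
    if "p \<in> P" "t \<in> {0..T}" for p v t
    using that by (intro integrable_continuous_real continuous_on_subset[OF contg]) auto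
  have contJ: "continuous_on {0..T} (J p v)" if "p \<in> P" for p v
    unfolding J_def using T by (intro indefinite_integral_continuous_1 intg that) auto
  define F where "F p w v = Bcontfun (\<lambda>t. exp (- (k * r t)) *\<^sub>R (w + J p v (r t)))" for p w v
  have F: "apply_bcontfun (F p w v) t = exp (- (k * r t)) *\<^sub>R (w + J p v (r t))" if "p \<in> P" for p w v t
  proof -
    let ?h = "\<lambda>t. exp (- (k * t)) *\<^sub>R (w + J p v t)"
    have c: "continuous_on {0..T} ?h"
      by (intro continuous_intros contJ that)
    have "continuous_on UNIV (\<lambda>t. ?h (r t))"
      using continuous_on_compose2[OF c contr] r by blast
    moreover have "range (\<lambda>t. ?h (r t)) \<subseteq> ?h ` {0..T}"
      using r by blast
    then have "bounded (range (\<lambda>t. ?h (r t)))"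
      using bounded_subset compact_imp_bounded[OF compact_continuous_image[OF c compact_Icc]] by blast
    ultimately show ?thesis
      unfolding F_def by (subst Bcontfun_inverse) (auto simp: bcontfun_def)
  qed
  have F_contract: "dist (F p w v) (F p w v') \<le> 1 / 2 * dist v v'" if p: "p \<in> P" for p w v v'
  proof (rule dist_bound)
    fix t
    let ?d = "dist v v'"
    \<comment> \<open>The weight grows at rate \<open>k\<close>, so integrating it gains the factor \<open>1 / k\<close>.\<close>
    have E: "((\<lambda>s. \<bar>L\<bar> * ?d * exp (k * s)) has_integral \<bar>L\<bar> * ?d / k * exp (k * r t) - \<bar>L\<bar> * ?d / k * exp (k * 0)) {0..r t}"
      using r(1)[of t] k(1)
      by (intro fundamental_theorem_of_calculus)
        (auto intro!: derivative_eq_intros simp: has_real_derivative_iff_has_vector_derivative[symmetric])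
    have "norm (J p v (r t) - J p v' (r t)) \<le> integral {0..r t} (\<lambda>s. \<bar>L\<bar> * ?d * exp (k * s))"
      unfolding J_def
    proof (subst integral_diff[symmetric], goal_cases)
      case 3
      show ?case
      proof (rule integral_norm_bound_integral, goal_cases)
        case (3 s)
        then have s: "s \<in> {0..T}"
          using r(1)[of t] by auto
        have "norm (g p s (exp (k * s) *\<^sub>R apply_bcontfun v s) - g p s (exp (k * s) *\<^sub>R apply_bcontfun v' s))
            \<le> \<bar>L\<bar> * (exp (k * s) * dist (apply_bcontfun v s) (apply_bcontfun v' s))"
          using lip[OF p s] by (rule order_trans)
            (auto simp: dist_norm abs_mult mult_right_mono simp flip: scaleR_diff_right)
        also have "\<dots> \<le> \<bar>L\<bar> * (exp (k * s) * ?d)"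
          by (intro mult_left_mono dist_bounded) auto
        finally show ?case
          by (simp add: mult_ac)
      qed (use p r(1) E in \<open>auto intro!: integrable_diff intg\<close>)
    qed (use p r(1) in \<open>auto intro!: intg\<close>)
    also have "\<dots> = \<bar>L\<bar> * ?d / k * exp (k * r t) - \<bar>L\<bar> * ?d / k * exp (k * 0)"
      using E by (rule integral_unique)
    also have "\<dots> \<le> \<bar>L\<bar> * ?d / k * exp (k * r t)"
      using k(1) by simp
    also have "\<dots> \<le> 1 / 2 * ?d * exp (k * r t)"
      using k mult_right_mono[OF k(2), of ?d] by (intro mult_right_mono) (auto simp: field_simps)
    finally have "exp (- (k * r t)) * norm (J p v (r t) - J p v' (r t)) \<le> exp (- (k * r t)) * (1 / 2 * ?d * exp (k * r t))"
      by (intro mult_left_mono) auto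
    also have "\<dots> = 1 / 2 * ?d"
      by (simp add: exp_minus)
    finally show "dist (apply_bcontfun (F p w v) t) (apply_bcontfun (F p w v') t) \<le> 1 / 2 * ?d"
      using p by (simp add: F dist_norm flip: scaleR_diff_right)
  qed
  define V where "V p w = (THE v. F p w v = v)" for p w
  have V: "F p w (V p w) = V p w" if "p \<in> P" for p w
    unfolding V_def
    by (rule theI'[OF banach_fix_type[of "1/2"]]) (use F_contract[OF that] in auto)
  \<comment> \<open>The distance of two fixed points is controlled by how far the second one is from being
    fixed by the first operator.\<close>
  have V_near: "dist (V p w) (V q w') \<le> 2 * dist (F p w (V q w')) (V q w')" if "p \<in> P" for p q w w'
  proof -
    have "dist (V p w) (V q w') \<le> dist (F p w (V p w)) (F p w (V q w')) + dist (F p w (V q w')) (V q w')"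
      by (subst V[OF that, symmetric]) (rule dist_triangle)
    then show ?thesis
      using F_contract[OF that, of w "V p w" "V q w'"] by simp
  qed
  define X where "X p w t = exp (k * t) *\<^sub>R apply_bcontfun (V p w) t" for p w t
  have X: "X p w t = w + integral {0..t} (\<lambda>s. g p s (X p w s))" if "p \<in> P" "t \<in> {0..T}" for p w t
  proof -
    have "X p w t = exp (k * t) *\<^sub>R apply_bcontfun (F p w (V p w)) t"
      using V that by (simp add: X_def)
    then show ?thesis
      using F[OF that(1), of w "V p w" t] r(2)[OF that(2)]
      by (simp add: X_def[symmetric] J_def flip: exp_add)
  qed
  show thesis
  proof
    show "X p w 0 = w" if "p \<in> P" for p w
      using X[OF that, of 0] T by simp
    show "(X p w has_vector_derivative g p t (X p w t)) (at t within {0..T})" if "p \<in> P" "t \<in> {0..T}" for p w t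
    proof -
      have "continuous_on {0..T} (\<lambda>s. g p s (X p w s))"
        using contg[OF that(1), of "V p w"] by (simp add: X_def)
      then have "((\<lambda>t. w + integral {0..t} (\<lambda>s. g p s (X p w s))) has_vector_derivative 0 + g p t (X p w t)) (at t within {0..T})"
        using that(2) by (intro has_vector_derivative_add integral_has_vector_derivative) auto
      then show ?thesis
        using has_vector_derivative_transform[OF that(2) X[OF that(1)]] by simp
    qed
    \<comment> \<open>Only the operators along the single trajectory \<open>V q w'\<close> have to be compared, and that
      trajectory runs in a compact set.\<close>
    have contPV: "continuous_on (P \<times> UNIV) (\<lambda>(p, w). V p w)"
      unfolding continuous_on_iff
    proof (safe, goal_cases)
      case (1 q w' e)
      then have q: "q \<in> P" and e: "e > 0"
        by auto
      have cont': "continuous_on (P \<times> {0..T}) (\<lambda>y. g (fst y) (snd y) (exp (k * snd y) *\<^sub>R apply_bcontfun (V q w') (snd y)))"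
      proof -
        have "continuous_on (P \<times> {0..T}) (\<lambda>y. (fst y, snd y, exp (k * snd y) *\<^sub>R apply_bcontfun (V q w') (snd y)))"
          by (intro continuous_intros continuous_on_compose2[OF continuous_on_apply_bcontfun[of UNIV]]) auto
        from continuous_on_compose2[OF cont this] show ?thesis
          by (simp add: image_subset_iff mem_Times_iff)
      qed
      obtain U where U: "q \<in> U" "open U"
        "\<forall>p\<in>U \<inter> P. \<forall>s\<in>{0..T}. dist (g p s (exp (k * s) *\<^sub>R apply_bcontfun (V q w') s))
            (g q s (exp (k * s) *\<^sub>R apply_bcontfun (V q w') s)) \<le> e / (8 * T)"
        using continuous_on_prod_compactE[OF cont' compact_Icc q, of "e / (8 * T)"] e T
        unfolding fst_conv snd_conv by (metis divide_pos_pos mult_pos_pos zero_less_numeral)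
      obtain d where d: "d > 0" "ball q d \<subseteq> U"
        using U(1,2) openE by blast
      show ?case
      proof (intro exI[of _ "min d (e / 8)"] conjI ballI impI)
        show "min d (e / 8) > 0"
          using d(1) e by simp
        fix y assume y: "y \<in> P \<times> (UNIV :: 'a set)" "dist y (q, w') < min d (e / 8)"
        obtain p w where [simp]: "y = (p, w)"
          by (cases y)
        have pw: "p \<in> P" "p \<in> U" "dist w w' < e / 8"
          using y d(2) dist_fst_le[of y "(q, w')"] dist_snd_le[of y "(q, w')"]
          by (auto simp: dist_commute subset_iff)
        have "dist (F p w (V q w')) (F q w' (V q w')) \<le> e / 4"
        proof (rule dist_bound)
          fix t
          have rt: "r t \<in> {0..T}" "r t \<le> T"
            using r(1)[of t] by auto
          have "norm (J p (V q w') (r t) - J q (V q w') (r t)) \<le> integral {0..r t} (\<lambda>s. e / (8 * T))"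
            unfolding J_def
          proof (subst integral_diff[symmetric], goal_cases)
            case 3
            show ?case
            proof (rule integral_norm_bound_integral, goal_cases)
              case (3 s)
              then show ?case
                using U(3) pw rt by (auto simp: dist_norm)
            qed (use pw q rt in \<open>auto intro!: integrable_diff intg\<close>)
          qed (use pw q rt in \<open>auto intro!: intg\<close>)
          also have "\<dots> = r t * (e / (8 * T))"
            using rt by simp
          also have "\<dots> \<le> T * (e / (8 * T))"
            using rt T e by (intro mult_right_mono) auto
          also have "\<dots> = e / 8"
            using T by simp
          finally have i: "norm (J p (V q w') (r t) - J q (V q w') (r t)) \<le> e / 8" .
          have "dist (apply_bcontfun (F p w (V q w')) t) (apply_bcontfun (F q w' (V q w')) t)
              = exp (- (k * r t)) * norm ((w - w') + (J p (V q w') (r t) - J q (V q w') (r t)))"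
            by (simp only: F[OF pw(1)] F[OF q] dist_norm scaleR_diff_right[symmetric] norm_scaleR
                add_diff_add abs_exp_cancel)
          also have "\<dots> \<le> 1 * norm ((w - w') + (J p (V q w') (r t) - J q (V q w') (r t)))"
            using rt k(1) by (intro mult_right_mono) auto
          also have "\<dots> \<le> e / 8 + e / 8"
            using pw(3) i by (simp add: dist_norm) (smt (verit) norm_triangle_ineq)
          finally show "dist (apply_bcontfun (F p w (V q w')) t) (apply_bcontfun (F q w' (V q w')) t) \<le> e / 4"
            by simp
        qed
        then have "dist (V p w) (V q w') \<le> e / 2"
          using V_near[OF pw(1), of w q w'] V[OF q, of w'] by simp
        then show "dist (case y of (p, w) \<Rightarrow> V p w) (V q w') < e"
          using e by simp
      qed
    qed
    have "continuous_on (P \<times> UNIV \<times> {0..T}) (\<lambda>y. (fst y, fst (snd y)) :: 'p \<times> 'a)"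
      by (intro continuous_intros)
    then have "continuous_on (P \<times> UNIV \<times> {0..T}) (\<lambda>y. case (fst y, fst (snd y)) of (p, w) \<Rightarrow> V p w)"
      by (rule continuous_on_compose2[OF contPV]) auto
    then have contV: "continuous_on (P \<times> UNIV \<times> {0..T}) (\<lambda>y. V (fst y) (fst (snd y)))"
      by (simp only: prod.case)
    have "continuous_on (P \<times> UNIV \<times> {0..T}) (\<lambda>y. apply_bcontfun (V (fst y) (fst (snd y))) (snd (snd y)))"
      unfolding continuous_on_def
    proof (intro ballI)
      fix y assume y: "y \<in> P \<times> (UNIV :: 'a set) \<times> {0..T}"
      define l where "l = V (fst y) (fst (snd y))"
      have "((\<lambda>y. V (fst y) (fst (snd y))) \<longlongrightarrow> l) (at y within P \<times> UNIV \<times> {0..T})"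
        using contV y unfolding continuous_on_def l_def by blast
      then have "((\<lambda>y. dist (V (fst y) (fst (snd y))) l) \<longlongrightarrow> 0) (at y within P \<times> UNIV \<times> {0..T})"
        by (rule iffD1[OF tendsto_dist_iff])
      moreover have "isCont (apply_bcontfun l) (snd (snd y))"
        using iffD1[OF continuous_on_eq_continuous_at[OF open_UNIV] continuous_on_apply_bcontfun] by blast
      then have "((\<lambda>y. apply_bcontfun l (snd (snd y))) \<longlongrightarrow> apply_bcontfun l (snd (snd y))) (at y within P \<times> UNIV \<times> {0..T})"
        by (rule isCont_tendsto_compose) (intro tendsto_intros)
      ultimately have lim: "((\<lambda>z. dist (V (fst z) (fst (snd z))) l + dist (apply_bcontfun l (snd (snd z))) (apply_bcontfun l (snd (snd y)))) \<longlongrightarrow> 0)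
          (at y within P \<times> UNIV \<times> {0..T})"
        by (intro tendsto_add_zero) (simp_all only: tendsto_dist_iff[symmetric])
      have "norm (dist (apply_bcontfun (V (fst z) (fst (snd z))) (snd (snd z))) (apply_bcontfun l (snd (snd y))))
          \<le> dist (V (fst z) (fst (snd z))) l + dist (apply_bcontfun l (snd (snd z))) (apply_bcontfun l (snd (snd y)))" for z
        using dist_triangle[of "apply_bcontfun (V (fst z) (fst (snd z))) (snd (snd z))"
            "apply_bcontfun l (snd (snd y))" "apply_bcontfun l (snd (snd z))"]
          dist_bounded[of "V (fst z) (fst (snd z))" "snd (snd z)" l] by simp
      with lim have "((\<lambda>z. dist (apply_bcontfun (V (fst z) (fst (snd z))) (snd (snd z))) (apply_bcontfun l (snd (snd y)))) \<longlongrightarrow> 0)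
          (at y within P \<times> UNIV \<times> {0..T})"
        by (intro Lim_null_comparison[OF always_eventually lim] allI)
      then show "((\<lambda>z. apply_bcontfun (V (fst z) (fst (snd z))) (snd (snd z))) \<longlongrightarrow> apply_bcontfun (V (fst y) (fst (snd y))) (snd (snd y)))
          (at y within P \<times> UNIV \<times> {0..T})"
        unfolding l_def by (rule iffD2[OF tendsto_dist_iff])
    qed
    then show "continuous_on (P \<times> UNIV \<times> {0..T}) (\<lambda>(p, w, t). X p w t)"
      unfolding X_def case_prod_beta by (intro continuous_intros) auto
  qed
qed

text \<open>
  Uniqueness by an energy estimate: \<open>exp(-2Lt) |d(t)|\<^sup>2\<close> is nonincreasing.
\<close>

lemma linear_ode_zero:
  fixes d :: "real \<Rightarrow> 'a::real_inner"
  assumes der: "\<And>t. t \<in> {0..T} \<Longrightarrow> (d has_vector_derivative A t (d t)) (at t within {0..T})"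
    and A: "\<And>t u. t \<in> {0..T} \<Longrightarrow> norm (A t u) \<le> L * norm u"
    and d0: "d 0 = 0" and t: "t \<in> {0..T}"
  shows "d t = 0"
proof -
  define h where "h s = exp (- (2 * L * s)) * (d s \<bullet> d s)" for s
  have "continuous_on {0..T} d"
    using der by (rule continuous_on_vector_derivative)
  then have conth: "continuous_on {0..t} h"
    unfolding h_def using t by (intro continuous_intros) (auto intro: continuous_on_subset)
  have "\<exists>y. (h has_real_derivative y) (at s) \<and> y \<le> 0" if "0 < s" "s < t" for s
  proof -
    have s: "s \<in> {0..T}" "at s within {0..T} = at s"
      using that t by (auto simp: at_within_Icc_at)
    have "((\<lambda>s. d s \<bullet> d s) has_vector_derivative d s \<bullet> A s (d s) + A s (d s) \<bullet> d s) (at s)"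
      using bounded_bilinear.has_vector_derivative[OF bounded_bilinear_inner der[OF s(1)] der[OF s(1)]] s(2)
      by simp
    then have "((\<lambda>s. d s \<bullet> d s) has_real_derivative 2 * (A s (d s) \<bullet> d s)) (at s)"
      by (simp add: has_real_derivative_iff_has_vector_derivative inner_commute)
    then have "(h has_real_derivative 2 * exp (- (2 * L * s)) * (A s (d s) \<bullet> d s - L * (d s \<bullet> d s))) (at s)"
      unfolding h_def by (auto intro!: derivative_eq_intros simp: algebra_simps)
    moreover have "A s (d s) \<bullet> d s \<le> L * (d s \<bullet> d s)"
      using norm_cauchy_schwarz[of "A s (d s)" "d s"] mult_right_mono[OF A[OF s(1), of "d s"], of "norm (d s)"]
      by (simp add: dot_square_norm power2_eq_square mult.assoc)
    ultimately show ?thesis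
      by (auto simp: mult_le_0_iff intro!: exI)
  qed
  then have "h t \<le> h 0"
    using t conth by (intro DERIV_nonpos_imp_decreasing_open[of 0 t h]) auto
  then have "d t \<bullet> d t \<le> 0"
    by (simp add: h_def d0 mult_le_0_iff)
  then show ?thesis
    by (metis inner_eq_zero_iff inner_ge_zero order_antisym)
qed

text \<open>
  The terms with \<open>A\<close> cancel in the derivative of \<open>z \<bullet> u\<close>, which leaves \<open>z \<bullet> h\<close>.
\<close>

lemma adjoint_pairing:
  fixes A :: "real \<Rightarrow> real ^ 'n ^ 'n" and z u h :: "real \<Rightarrow> real ^ 'n"
  assumes "T \<ge> 0"
    and z: "\<And>t. t \<in> {0..T} \<Longrightarrow> (z has_vector_derivative - (transpose (A t) *v z t)) (at t within {0..T})"
    and u: "\<And>t. t \<in> {0..T} \<Longrightarrow> (u has_vector_derivative A t *v u t + h t) (at t within {0..T})"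
  shows "((\<lambda>t. z t \<bullet> h t) has_integral z T \<bullet> u T - z 0 \<bullet> u 0) {0..T}"
proof (rule fundamental_theorem_of_calculus[OF assms(1)])
  fix t assume t: "t \<in> {0..T}"
  have "z t \<bullet> (A t *v u t + h t) + - (transpose (A t) *v z t) \<bullet> u t = z t \<bullet> h t"
    by (simp add: inner_add_right dot_lmul_matrix)
  then show "((\<lambda>t. z t \<bullet> u t) has_vector_derivative z t \<bullet> h t) (at t within {0..T})"
    using bounded_bilinear.has_vector_derivative[OF bounded_bilinear_inner z[OF t] u[OF t]] by simp
qed

text \<open>
  The equation for \<open>u\<close> described at the beginning. It is only locally Lipschitz, so \<open>\<epsilon> u\<close> is
  replaced by its projection to the unit ball. Cutting off \<open>\<epsilon> u\<close> rather than \<open>u\<close> keeps the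
  Lipschitz constant independent of \<open>\<epsilon>\<close> and does not change the equation at \<open>\<epsilon> = 0\<close>; for \<open>\<epsilon> > 0\<close> the
  original equation holds wherever \<open>|\<epsilon> u| \<le> 1\<close>.
\<close>

lemma rescaled_flow:
  fixes \<psi> :: "'a::euclidean_space \<Rightarrow> 'a" and \<Phi> :: "real \<times> 'a \<times> real \<Rightarrow> 'a" and x :: "real \<Rightarrow> 'a"
  assumes T: "T > 0"
    and der: "\<And>y. (\<psi> has_derivative D y) (at y)"
    and contD: "\<And>v. continuous_on UNIV (\<lambda>y. D y v)"
    and \<Phi>: "C_on (Suc k) (UNIV \<times> UNIV \<times> {0..1}) \<Phi>"
    and x: "continuous_on {0..T} x"
  obtains X where
    "\<And>\<epsilon> \<theta> w. \<epsilon> \<in> {0..1} \<Longrightarrow> \<theta> \<in> {a..b} \<Longrightarrow> X \<epsilon> \<theta> w 0 = w"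
    and "\<And>\<theta> w t. \<theta> \<in> {a..b} \<Longrightarrow> t \<in> {0..T} \<Longrightarrow>
      (X 0 \<theta> w has_vector_derivative D (x t) (X 0 \<theta> w t) + \<Phi> (t - \<theta>, x t, 0)) (at t within {0..T})"
    and "\<And>\<epsilon> \<theta> w t. \<epsilon> \<in> {0<..1} \<Longrightarrow> \<theta> \<in> {a..b} \<Longrightarrow> t \<in> {0..T} \<Longrightarrow> norm (\<epsilon> *\<^sub>R X \<epsilon> \<theta> w t) \<le> 1 \<Longrightarrow>
      (X \<epsilon> \<theta> w has_vector_derivative (1 / \<epsilon>) *\<^sub>R (\<psi> (x t + \<epsilon> *\<^sub>R X \<epsilon> \<theta> w t) - \<psi> (x t))
        + \<Phi> (t - \<theta>, x t + \<epsilon> *\<^sub>R X \<epsilon> \<theta> w t, \<epsilon>)) (at t within {0..T})"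
    and "continuous_on ({0..1} \<times> {a..b} \<times> UNIV \<times> {0..T}) (\<lambda>(\<epsilon>, \<theta>, w, t). X \<epsilon> \<theta> w t)"
proof -
  define r where "r = closest_point (cball (0::'a) 1)"
  have r: "continuous_on UNIV r" "\<And>v. norm v \<le> 1 \<Longrightarrow> r v = v" "\<And>v. norm (r v) \<le> 1"
    "\<And>u v. norm (r u - r v) \<le> norm (u - v)"
  proof -
    show "continuous_on UNIV r"
      unfolding r_def by (rule continuous_on_closest_point) auto
    show "r v = v" if "norm v \<le> 1" for v
      unfolding r_def using that by (intro closest_point_self) auto
    show "norm (r v) \<le> 1" for v
      using closest_point_in_set[of "cball (0::'a) 1" v] by (simp add: r_def)
    show "norm (r u - r v) \<le> norm (u - v)" for u v
      using closest_point_lipschitz[of "cball (0::'a) 1" u v] by (simp add: r_def dist_norm)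
  qed
  have "bounded (x ` {0..T})"
    using x by (intro compact_imp_bounded compact_continuous_image) auto
  then obtain R where R: "\<And>t. t \<in> {0..T} \<Longrightarrow> norm (x t) \<le> R"
    unfolding bounded_iff by blast
  define C where "C = cball (0::'a) (R + 1)"
  have C: "x t + r v \<in> C" "x t \<in> C" if "t \<in> {0..T}" for t v
    using R[OF that] r(3)[of v] norm_triangle_ineq[of "x t" "r v"] by (auto simp: C_def)
  obtain L1 where L1: "L1 > 0" "\<And>y v. y \<in> C \<Longrightarrow> norm (D y v) \<le> L1 * norm v"
    "\<And>y z. y \<in> C \<Longrightarrow> z \<in> C \<Longrightarrow> norm (\<psi> y - \<psi> z) \<le> L1 * norm (y - z)"
    by (rule lipschitz_on_compact_convex[of UNIV \<psi> D C])
      (use der contD in \<open>auto simp: C_def\<close>)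
  let ?S = "UNIV \<times> UNIV \<times> {0..1} :: (real \<times> 'a \<times> real) set"
  obtain \<Phi>' where \<Phi>': "\<And>p. p \<in> ?S \<Longrightarrow> (\<Phi> has_derivative \<Phi>' p) (at p within ?S)"
    "\<And>v. C_on k ?S (\<lambda>p. \<Phi>' p v)"
    using \<Phi> by auto
  let ?C2 = "{- b..T - a} \<times> C \<times> {0..1::real}"
  obtain L2 where L2: "L2 > 0" "\<And>y z. y \<in> ?C2 \<Longrightarrow> z \<in> ?C2 \<Longrightarrow> norm (\<Phi> y - \<Phi> z) \<le> L2 * norm (y - z)"
  proof (rule lipschitz_on_compact_convex[of ?S \<Phi> \<Phi>' ?C2])
    show "compact ?C2" "convex ?C2"
      by (auto simp: C_def intro!: compact_Times convex_Times)
  qed (use \<Phi>' C_on_imp_continuous_on in blast)+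
  define q where "q \<epsilon> t u = (if \<epsilon> = 0 then D (x t) u
    else (1 / \<epsilon>) *\<^sub>R (\<psi> (x t + r (\<epsilon> *\<^sub>R u)) - \<psi> (x t)))" for \<epsilon> t u
  have contq: "continuous_on ({0..1} \<times> {0..T} \<times> UNIV) (\<lambda>(\<epsilon>, t, u). q \<epsilon> t u)"
    unfolding q_def by (rule difference_quotient_continuous[OF der contD x r(1,2)])
  define g where "g p t u = q (fst p) t u + \<Phi> (t - snd p, x t + r (fst p *\<^sub>R u), fst p)" for p t u
  define P where "P = {0..1::real} \<times> {a..b}"
  have contg: "continuous_on (P \<times> {0..T} \<times> UNIV) (\<lambda>(p, t, u). g p t u)"
  proof -
    let ?Q = "P \<times> {0..T} \<times> (UNIV :: 'a set)"
    have "continuous_on ?Q (\<lambda>y. (fst (fst y), fst (snd y), snd (snd y)))"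
      by (intro continuous_intros)
    then have "continuous_on ?Q (\<lambda>y. case (fst (fst y), fst (snd y), snd (snd y)) of (\<epsilon>, t, u) \<Rightarrow> q \<epsilon> t u)"
      by (rule continuous_on_compose2[OF contq]) (auto simp: P_def)
    moreover have "continuous_on ?Q (\<lambda>y. \<Phi> (fst (snd y) - snd (fst y),
        x (fst (snd y)) + r (fst (fst y) *\<^sub>R snd (snd y)), fst (fst y)))"
      by (intro continuous_on_compose2[OF C_on_imp_continuous_on[OF \<Phi>]] continuous_intros
          continuous_on_compose2[OF x] continuous_on_compose2[OF r(1)]) (auto simp: P_def)
    ultimately show ?thesis
      by (simp add: g_def case_prod_beta continuous_on_add)
  qed
  have lip: "norm (g p t u - g p t v) \<le> (L1 + L2) * norm (u - v)"
    if p: "p \<in> P" and t: "t \<in> {0..T}" for p t u v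
  proof -
    obtain \<epsilon> \<theta> where [simp]: "p = (\<epsilon>, \<theta>)"
      by (cases p)
    have \<epsilon>: "0 \<le> \<epsilon>" "\<epsilon> \<le> 1" and \<theta>: "\<theta> \<in> {a..b}"
      using p by (auto simp: P_def)
    have rr: "norm (r (\<epsilon> *\<^sub>R u) - r (\<epsilon> *\<^sub>R v)) \<le> \<epsilon> * norm (u - v)"
      using r(4)[of "\<epsilon> *\<^sub>R u" "\<epsilon> *\<^sub>R v"] \<epsilon>(1) by (simp flip: scaleR_diff_right)
    have "norm (q \<epsilon> t u - q \<epsilon> t v) \<le> L1 * norm (u - v)"
    proof (cases "\<epsilon> = 0")
      case True
      have "linear (D (x t))"
        using der has_derivative_linear by blast
      from linear_diff[OF this] show ?thesis
        using True L1(2)[OF C(2)[OF t], of "u - v"] by (simp add: q_def)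
    next
      case False
      have "norm (q \<epsilon> t u - q \<epsilon> t v) = (1 / \<epsilon>) * norm (\<psi> (x t + r (\<epsilon> *\<^sub>R u)) - \<psi> (x t + r (\<epsilon> *\<^sub>R v)))"
        using False \<epsilon>(1) by (simp add: q_def flip: scaleR_diff_right)
      also have "\<dots> \<le> (1 / \<epsilon>) * (L1 * (\<epsilon> * norm (u - v)))"
        using L1(3)[OF C(1)[OF t] C(1)[OF t], of "\<epsilon> *\<^sub>R u" "\<epsilon> *\<^sub>R v"] L1(1) \<epsilon>(1)
        by (intro mult_left_mono[OF order_trans[OF _ mult_left_mono[OF rr]]]) auto
      finally show ?thesis
        using False by simp
    qed
    moreover have "norm (\<Phi> (t - \<theta>, x t + r (\<epsilon> *\<^sub>R u), \<epsilon>) - \<Phi> (t - \<theta>, x t + r (\<epsilon> *\<^sub>R v), \<epsilon>)) \<le> L2 * norm (u - v)"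
    proof -
      have "norm (\<Phi> (t - \<theta>, x t + r (\<epsilon> *\<^sub>R u), \<epsilon>) - \<Phi> (t - \<theta>, x t + r (\<epsilon> *\<^sub>R v), \<epsilon>))
          \<le> L2 * norm (r (\<epsilon> *\<^sub>R u) - r (\<epsilon> *\<^sub>R v))"
        using L2(2)[of "(t - \<theta>, x t + r (\<epsilon> *\<^sub>R u), \<epsilon>)" "(t - \<theta>, x t + r (\<epsilon> *\<^sub>R v), \<epsilon>)"] C(1)[OF t] t \<theta> \<epsilon>
        by (simp add: norm_Pair)
      also have "\<dots> \<le> L2 * (1 * norm (u - v))"
        using L2(1) \<epsilon> by (intro mult_left_mono order_trans[OF rr] mult_right_mono) auto
      finally show ?thesis
        by simp
    qed
    ultimately have "norm ((q \<epsilon> t u - q \<epsilon> t v) + (\<Phi> (t - \<theta>, x t + r (\<epsilon> *\<^sub>R u), \<epsilon>) - \<Phi> (t - \<theta>, x t + r (\<epsilon> *\<^sub>R v), \<epsilon>)))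
        \<le> L1 * norm (u - v) + L2 * norm (u - v)"
      by (rule norm_triangle_mono)
    then show ?thesis
      by (simp add: g_def algebra_simps)
  qed
  obtain X where X: "\<And>p w. p \<in> P \<Longrightarrow> X p w 0 = w"
    "\<And>p w t. p \<in> P \<Longrightarrow> t \<in> {0..T} \<Longrightarrow> (X p w has_vector_derivative g p t (X p w t)) (at t within {0..T})"
    "continuous_on (P \<times> UNIV \<times> {0..T}) (\<lambda>(p, w, t). X p w t)"
    using parametrized_flow[OF T contg lip] by blast
  show thesis
  proof (rule that[of "\<lambda>\<epsilon> \<theta>. X (\<epsilon>, \<theta>)"])
    show "X (\<epsilon>, \<theta>) w 0 = w" if "\<epsilon> \<in> {0..1}" "\<theta> \<in> {a..b}" for \<epsilon> \<theta> w
      using X(1) that by (simp add: P_def)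
    show "(X (0, \<theta>) w has_vector_derivative D (x t) (X (0, \<theta>) w t) + \<Phi> (t - \<theta>, x t, 0)) (at t within {0..T})"
      if "\<theta> \<in> {a..b}" "t \<in> {0..T}" for \<theta> w t
      using X(2)[of "(0, \<theta>)" t w] that r(2)[of 0] by (simp add: P_def g_def q_def)
    show "(X (\<epsilon>, \<theta>) w has_vector_derivative (1 / \<epsilon>) *\<^sub>R (\<psi> (x t + \<epsilon> *\<^sub>R X (\<epsilon>, \<theta>) w t) - \<psi> (x t))
        + \<Phi> (t - \<theta>, x t + \<epsilon> *\<^sub>R X (\<epsilon>, \<theta>) w t, \<epsilon>)) (at t within {0..T})"
      if "\<epsilon> \<in> {0<..1}" "\<theta> \<in> {a..b}" "t \<in> {0..T}" "norm (\<epsilon> *\<^sub>R X (\<epsilon>, \<theta>) w t) \<le> 1" for \<epsilon> \<theta> w t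
      using X(2)[of "(\<epsilon>, \<theta>)" t w] that(1-3) r(2)[OF that(4)] by (simp add: P_def g_def q_def)
    have "continuous_on ({0..1} \<times> {a..b} \<times> (UNIV :: 'a set) \<times> {0..T})
      (\<lambda>y. ((fst y, fst (snd y)), fst (snd (snd y)), snd (snd (snd y))))"
      by (intro continuous_intros)
    then have "continuous_on ({0..1} \<times> {a..b} \<times> UNIV \<times> {0..T})
      (\<lambda>y. case ((fst y, fst (snd y)), fst (snd (snd y)), snd (snd (snd y))) of (p, w, t) \<Rightarrow> X p w t)"
      by (rule continuous_on_compose2[OF X(3)]) (auto simp: P_def)
    then show "continuous_on ({0..1} \<times> {a..b} \<times> UNIV \<times> {0..T}) (\<lambda>(\<epsilon>, \<theta>, w, t). X (\<epsilon>, \<theta>) w t)"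
      by (simp add: case_prod_beta)
  qed
qed

section \<open>Periodic solutions\<close>

lemma periodic_shift_int:
  fixes f :: "real \<Rightarrow> 'a"
  assumes "\<And>t. f (t + T) = f t"
  shows "f (t + of_int k * T) = f t"
proof (induction k arbitrary: t rule: int_induct[where k = 0])
  case (step1 i)
  have "f (t + of_int (i + 1) * T) = f ((t + of_int i * T) + T)"
    by (simp add: algebra_simps)
  then show ?case
    using assms step1 by simp
next
  case (step2 i)
  have "f (t + of_int i * T) = f ((t + of_int (i - 1) * T) + T)"
    by (simp add: algebra_simps)
  then show ?case
    using assms step2 by simp
qed simp

lemma period_reduction:
  fixes t :: real
  assumes "T > 0"
  obtains s k where "s \<in> {0..<T}" and "t = s + of_int k * T"
proof
  show "t = (t - of_int \<lfloor>t / T\<rfloor> * T) + of_int \<lfloor>t / T\<rfloor> * T"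
    by simp
  show "t - of_int \<lfloor>t / T\<rfloor> * T \<in> {0..<T}"
    using floor_divide_lower[OF assms, of t] floor_divide_upper[OF assms, of t] by (auto simp: algebra_simps)
qed

lemma periodic_extension:
  fixes y :: "real \<Rightarrow> 'a"
  assumes "T > 0" and "y 0 = y T"
  obtains Y where "\<And>t. t \<in> {0..T} \<Longrightarrow> Y t = y t" and "\<And>t. Y (t + T) = Y t"
proof
  let ?Y = "\<lambda>t. y (t - of_int \<lfloor>t / T\<rfloor> * T)"
  show "?Y (t + T) = ?Y t" for t
    using assms(1) by (simp add: add_divide_distrib algebra_simps)
  show "?Y t = y t" if "t \<in> {0..T}" for t
  proof (cases "t = T")
    case False
    then have "\<lfloor>t / T\<rfloor> = 0"
      using that assms(1) by (simp add: floor_eq_iff)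
    then show ?thesis
      by simp
  qed (use assms in auto)
qed

lemma has_vector_derivative_shift_at:
  assumes "(f has_vector_derivative D) (at (t + c) within (\<lambda>s. s + c) ` S)"
  shows "((\<lambda>s. f (s + c)) has_vector_derivative D) (at t within S)"
proof -
  have "((\<lambda>s. s + c) has_vector_derivative 1) (at t within S)"
    by (auto intro!: derivative_eq_intros)
  from vector_diff_chain_within[OF this assms] show ?thesis
    by (simp add: o_def)
qed

text \<open>
  At multiples of the period the one-sided derivatives at the two ends of \<open>[0,T]\<close> are glued.
\<close>

lemma periodic_solution_has_vector_derivative:
  assumes T: "T > 0" and sol: "periodic_solution T F x" and F: "\<And>t y. F (t + T) y = F t y"
  shows "(x has_vector_derivative F t (x t)) (at t)"
proof -
  have der: "(x has_vector_derivative F t (x t)) (at t within {0..T})" if "t \<in> {0..T}" for t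
    using sol that by (auto simp: periodic_solution_def)
  have per: "x (t + T) = x t" for t
    using sol by (auto simp: periodic_solution_def)
  have base: "(x has_vector_derivative F s (x s)) (at s)" if s: "s \<in> {0..<T}" for s
  proof (cases "s = 0")
    case False
    then show ?thesis
      using der[of s] s by (simp add: at_within_Icc_at)
  next
    case True
    have "(x has_vector_derivative F 0 (x 0)) (at (0 + T) within (\<lambda>s. s + T) ` {- T..0})"
      using der[of T] T F[of 0] per[of 0] by simp
    then have "((\<lambda>s. x (s + T)) has_vector_derivative F 0 (x 0)) (at 0 within {- T..0})"
      by (rule has_vector_derivative_shift_at)
    then have "(x has_vector_derivative F 0 (x 0)) (at 0 within {- T..0})"
      by (simp add: per)
    moreover have "(x has_vector_derivative F 0 (x 0)) (at 0 within {0..T})"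
      using der[of 0] T by simp
    ultimately have "(x has_vector_derivative F 0 (x 0)) (at 0 within {- T..0} \<union> {0..T})"
      unfolding has_vector_derivative_def has_derivative_within by (auto intro: Lim_Un)
    moreover have "{- T..0} \<union> {0..T} = {- T..T}"
      using T by auto
    ultimately show ?thesis
      using True T by (simp add: at_within_Icc_at)
  qed
  obtain s k where s: "s \<in> {0..<T}" "t = s + of_int k * T"
    using period_reduction[OF T] .
  have Fk: "F (u + of_int k * T) = F u" for u k
    by (rule periodic_shift_int) (use F in auto)
  have xk: "x (u + of_int k * T) = x u" for u k
    by (rule periodic_shift_int) (use per in auto)
  have "((\<lambda>u. x (u + of_int (- k) * T)) has_vector_derivative F s (x s)) (at t)"
    using has_vector_derivative_shift_at[of x "F s (x s)" t "of_int (- k) * T" UNIV] base[OF s(1)] s(2)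
    by (simp add: surj_plus_right)
  then show ?thesis
    unfolding xk using s(2) Fk xk by simp
qed

text \<open>
  A periodic orbit found in the shifted time \<open>\<tau> = t + \<theta>\<close>, in which the equation has the right-hand
  side \<open>F (\<tau> - \<theta>)\<close>, is carried back to the time \<open>t\<close>. The values of the result are values of \<open>y\<close> at
  times reduced to \<open>[0,T]\<close>, so estimates on \<open>y\<close> transfer.
\<close>

lemma periodic_solution_shift:
  fixes y :: "real \<Rightarrow> real ^ 'n"
  assumes T: "T > 0" and F: "\<And>t v. F (t + T) v = F t v"
    and y: "\<And>t. t \<in> {0..T} \<Longrightarrow> (y has_vector_derivative F (t - \<theta>) (y t)) (at t within {0..T})"
    and yT: "y 0 = y T"
  obtains x where "periodic_solution T F x"
    and "\<And>t. \<exists>s\<in>{0..T}. \<exists>k. t + \<theta> = s + of_int k * T \<and> x t = y s"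
proof -
  obtain Y where Y: "\<And>t. t \<in> {0..T} \<Longrightarrow> Y t = y t" "\<And>t. Y (t + T) = Y t"
    by (rule periodic_extension[OF T yT]) blast
  have "periodic_solution T (\<lambda>t. F (t - \<theta>)) Y"
    unfolding periodic_solution_def
  proof (intro conjI ballI allI)
    fix t assume t: "t \<in> {0..T}"
    show "(Y has_vector_derivative F (t - \<theta>) (Y t)) (at t within {0..T})"
      using has_vector_derivative_transform[OF t Y(1) y[OF t]] Y(1)[OF t] by simp
  qed (use Y yT T in auto)
  moreover have "F (t + T - \<theta>) v = F (t - \<theta>) v" for t v
    using F[of "t - \<theta>" v] by (simp add: algebra_simps)
  ultimately have Yder: "(Y has_vector_derivative F (t - \<theta>) (Y t)) (at t)" for t
    using periodic_solution_has_vector_derivative[OF T, of "\<lambda>t. F (t - \<theta>)" Y] by blast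
  define x where "x t = Y (t + \<theta>)" for t
  have per: "x (t + T) = x t" for t
    using Y(2)[of "t + \<theta>"] by (simp add: x_def algebra_simps)
  show thesis
  proof
    show "periodic_solution T F x"
      unfolding periodic_solution_def
    proof (intro conjI ballI allI)
      fix t
      have "((\<lambda>s. Y (s + \<theta>)) has_vector_derivative F t (Y (t + \<theta>))) (at t within {0..T})"
        by (rule has_vector_derivative_shift_at, rule has_vector_derivative_at_within)
          (use Yder[of "t + \<theta>"] in simp)
      then show "(x has_vector_derivative F t (x t)) (at t within {0..T})"
        by (simp add: x_def[abs_def])
    qed (use per per[of 0] in auto)
    show "\<exists>s\<in>{0..T}. \<exists>k. t + \<theta> = s + of_int k * T \<and> x t = y s" for t
    proof -
      obtain s k where sk: "s \<in> {0..<T}" "t + \<theta> = s + of_int k * T"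
        using period_reduction[OF T] .
      have "Y (s + of_int k * T) = Y s"
        by (rule periodic_shift_int) (use Y in auto)
      then show ?thesis
        using sk Y(1)[of s] by (intro bexI[of _ s] exI[of _ k]) (auto simp: x_def)
    qed
  qed
qed

section \<open>The eigenspace of a simple multiplier\<close>

lemma mat_mult_vec: "mat x *v u = x *\<^sub>R u" for x :: real
  by (simp add: vec_eq_iff matrix_vector_mult_def mat_def if_distrib[of "\<lambda>a. a * _"] cong: if_cong)

lemma poly_charpoly: "poly (charpoly M) x = det (mat x - M)"
  by (simp add: charpoly_def det_def poly_sum poly_prod mat_def if_distrib[of "\<lambda>p. poly p x"] cong: if_cong)

text \<open>
  Needed because the order of a root is meaningful for nonzero polynomials only. Above the operator
  norm of \<open>M\<close> the matrix \<open>x - M\<close> is injective.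
\<close>

lemma charpoly_nonzero: "charpoly M \<noteq> 0"
proof
  assume "charpoly M = 0"
  define x where "x = onorm ((*v) M) + 1"
  have bl: "bounded_linear ((*v) M)"
    by (simp add: matrix_vector_mul_bounded_linear)
  then have x: "x > 0" "\<And>v. norm (M *v v) \<le> (x - 1) * norm v"
    using onorm_pos_le[OF bl] onorm[OF bl] by (auto simp: x_def)
  have "inj ((*v) (mat x - M))"
  proof (subst matrix_vector_mul_linear[THEN linear_injective_0], safe)
    fix v assume "(mat x - M) *v v = 0"
    then have "M *v v = x *\<^sub>R v"
      by (simp add: matrix_vector_mult_diff_rdistrib mat_mult_vec)
    then show "v = 0"
      using x(2)[of v] x(1) by (auto simp: algebra_simps)
  qed
  then have "det (mat x - M) \<noteq> 0"
    using det_nz_iff_inj[of "(*v) (mat x - M)"] by (simp add: matrix_vector_mul_linear)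
  then show False
    using \<open>charpoly M = 0\<close> poly_charpoly[of M x] by simp
qed

text \<open>
  The geometric multiplicity is at most the algebraic one. If there were a second independent
  eigenvector, Cramer's rule would trade two columns of \<open>(1 + s) - M\<close> for multiples \<open>s v\<^sub>0\<close> and
  \<open>s v\<close> of eigenvectors, so its determinant would vanish to second order at \<open>s = 0\<close>.
\<close>

lemma eigenspace_of_simple_root:
  fixes M :: "real ^ 'n ^ 'n"
  assumes ord: "order 1 (charpoly M) = 1"
    and v0: "M *v v0 = v0" "v0 \<noteq> 0" and v1: "M *v v1 = v1"
  obtains c where "v1 = c *\<^sub>R v0"
proof (rule ccontr)
  assume "\<not> thesis"
  obtain i where i: "v0 $ i \<noteq> 0"
    using v0(2) by (auto simp: vec_eq_iff)
  \<comment> \<open>Eliminating coordinate \<open>i\<close> makes the two successive column replacements independent.\<close>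
  define v where "v = v1 - (v1 $ i / v0 $ i) *\<^sub>R v0"
  have Mv: "M *v v = v"
    by (simp add: v_def v0 v1 matrix_vector_mult_diff_distrib matrix_vector_mult_scaleR)
  have vi: "v $ i = 0"
    using i by (simp add: v_def)
  have "v \<noteq> 0"
    using \<open>\<not> thesis\<close> that by (auto simp: v_def)
  then obtain j where j: "v $ j \<noteq> 0"
    by (auto simp: vec_eq_iff)
  have ij: "i \<noteq> j"
    using vi j by auto
  define A where "A s = mat (1 + s) - M" for s
  have A: "A s *v v0 = s *\<^sub>R v0" "A s *v v = s *\<^sub>R v" for s
    by (auto simp: A_def v0 Mv mat_mult_vec matrix_vector_mult_diff_rdistrib algebra_simps)
  define A1 where "A1 s = (\<chi> r k. if k = i then (A s *v v0) $ r else A s $ r $ k)" for s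
  define Q where "Q s = (\<chi> r k. if k = i then v0 $ r else if k = j then v $ r else A s $ r $ k)" for s
  \<comment> \<open>The replaced matrix is \<open>Q s ** D s\<close>: the factor \<open>D s\<close> collects the two factors \<open>s\<close>.\<close>
  define D where "D s = (\<chi> r k. if r = k then if k = i \<or> k = j then s else 1 else 0)" for s :: real
  have A1v: "A1 s *v v = s *\<^sub>R v" for s
  proof -
    have "A1 s *v v = A s *v v"
      unfolding A1_def matrix_vector_mult_def vec_eq_iff using vi by (auto intro!: sum.cong)
    then show ?thesis
      by (simp add: A)
  qed
  have "det (D s) = s * s" for s
  proof -
    have "det (D s) = (\<Prod>k\<in>UNIV. if k = i \<or> k = j then s else 1)"
      by (subst det_diagonal) (auto simp: D_def)
    also have "\<dots> = (\<Prod>k\<in>{i, j}. s)"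
      by (rule prod.mono_neutral_cong_right) auto
    finally show ?thesis
      using ij by simp
  qed
  moreover have "v $ j * (v0 $ i * det (A s)) = det (Q s ** D s)" for s
  proof -
    have "v $ j * det (A1 s) = det (\<chi> r k. if k = j then (A1 s *v v) $ r else A1 s $ r $ k)"
      by (simp add: cramer_lemma)
    also have "(\<chi> r k. if k = j then (A1 s *v v) $ r else A1 s $ r $ k) = Q s ** D s"
      unfolding vec_eq_iff matrix_matrix_mult_def A1v
      using ij by (auto simp: A1_def A Q_def D_def if_distrib[of "\<lambda>a. _ * a"] cong: if_cong)
    finally show ?thesis
      by (simp add: A1_def cramer_lemma)
  qed
  ultimately have detA: "v $ j * (v0 $ i * det (A s)) = det (Q s) * (s * s)" for s
    by (simp add: det_mul)
  obtain q where q: "charpoly M = [:- 1, 1:] * q" "\<not> [:- 1, 1:] dvd q"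
    using order_decomp[OF charpoly_nonzero[of M], of 1] ord by auto
  have q1: "poly q 1 \<noteq> 0"
    using q(2) by (simp add: poly_eq_0_iff_dvd)
  have "v $ j * (v0 $ i * poly q (1 + s)) = det (Q s) * s" if "s \<noteq> 0" for s
  proof -
    have "det (A s) = s * poly q (1 + s)"
      by (simp add: A_def flip: poly_charpoly) (simp add: q(1) algebra_simps)
    then show ?thesis
      using detA[of s] that by simp
  qed
  then have eq: "\<forall>\<^sub>F s in at 0. v $ j * (v0 $ i * poly q (1 + s)) = det (Q s) * s"
    by (auto simp: eventually_at_filter)
  have limr: "((\<lambda>s. det (Q s) * s) \<longlongrightarrow> det (Q 0) * 0) (at 0)"
  proof (intro tendsto_intros)
    have "((\<lambda>s. Q s $ r $ k) \<longlongrightarrow> Q 0 $ r $ k) (at 0)" for r k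
      by (cases "r = k") (auto simp: Q_def A_def mat_def intro!: tendsto_eq_intros)
    then show "((\<lambda>s. det (Q s)) \<longlongrightarrow> det (Q 0)) (at 0)"
      unfolding det_def by (intro tendsto_sum tendsto_mult tendsto_const tendsto_prod)
  qed
  have "((\<lambda>s. v $ j * (v0 $ i * poly q (1 + s))) \<longlongrightarrow> v $ j * (v0 $ i * poly q (1 + 0))) (at 0)"
    by (intro tendsto_intros)
  from Lim_transform_eventually[OF this eq]
  have "v $ j * (v0 $ i * poly q (1 + 0)) = det (Q 0) * 0"
    using limr by (rule tendsto_unique[OF trivial_limit_at])
  then show False
    using i j q1 by simp
qed

section \<open>The Malkin integral at a zero of order three\<close>

text \<open>
  The bifurcation integral without its sign factor, for an arbitrary integrand \<open>\<Phi>\<close>, so that its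
  derivatives are integrals of the same kind.
\<close>

definition melnikov ::
    "real \<Rightarrow> (real \<Rightarrow> 'a::euclidean_space) \<Rightarrow> (real \<Rightarrow> 'b::euclidean_space) \<Rightarrow> (real \<times> 'b \<times> real \<Rightarrow> 'a) \<Rightarrow> real \<Rightarrow> real"
  where "melnikov T z x \<Phi> \<theta> = integral {0..T} (\<lambda>\<tau>. z \<tau> \<bullet> \<Phi> (\<tau> - \<theta>, x \<tau>, 0))"

text \<open>
  Differentiation under the integral sign: each derivative in \<open>\<theta>\<close> replaces \<open>\<Phi>\<close> by minus its time
  derivative and uses up one order of smoothness.
\<close>

lemma melnikov_has_derivative:
  fixes \<Phi> :: "real \<times> 'b::euclidean_space \<times> real \<Rightarrow> 'a::euclidean_space"
  assumes z: "continuous_on {0..T} z" and x: "continuous_on {0..T} x"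
    and \<Phi>: "C_on (Suc k) (UNIV \<times> UNIV \<times> {0..1}) \<Phi>"
  obtains \<Phi>1 where "C_on k (UNIV \<times> UNIV \<times> {0..1}) \<Phi>1"
    and "\<And>\<theta>. (melnikov T z x \<Phi> has_real_derivative melnikov T z x \<Phi>1 \<theta>) (at \<theta>)"
proof -
  let ?S = "UNIV \<times> UNIV \<times> {0..1} :: (real \<times> 'b \<times> real) set"
  obtain \<Phi>' where \<Phi>': "\<And>p. p \<in> ?S \<Longrightarrow> (\<Phi> has_derivative \<Phi>' p) (at p within ?S)"
    "\<And>v. C_on k ?S (\<lambda>p. \<Phi>' p v)"
    using \<Phi> by auto
  define \<Phi>1 where "\<Phi>1 p = \<Phi>' p (- 1, 0, 0)" for p
  have C1: "C_on k ?S \<Phi>1"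
    unfolding \<Phi>1_def by (rule \<Phi>'(2))
  have cont: "continuous_on (UNIV \<times> {0..T}) (\<lambda>q. z (snd q) \<bullet> \<Psi> (snd q - fst q, x (snd q), 0))"
    if "C_on m ?S \<Psi>" for m and \<Psi> :: "real \<times> 'b \<times> real \<Rightarrow> 'a"
    by (intro continuous_intros continuous_on_compose2[OF z] continuous_on_compose2[OF x]
        continuous_on_compose2[OF C_on_imp_continuous_on[OF that]]) auto
  have der: "((\<lambda>\<theta>. z \<tau> \<bullet> \<Phi> (\<tau> - \<theta>, x \<tau>, 0)) has_real_derivative z \<tau> \<bullet> \<Phi>1 (\<tau> - \<theta>, x \<tau>, 0)) (at \<theta>)" for \<tau> \<theta>
  proof -
    let ?c = "\<lambda>\<theta>. (\<tau> - \<theta>, x \<tau>, 0 :: real)"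
    have "(?c has_derivative (\<lambda>h. (- h, 0, 0))) (at \<theta>)"
      by (intro has_derivative_Pair has_derivative_const) (auto intro!: derivative_eq_intros)
    moreover have "(\<Phi> has_derivative \<Phi>' (?c \<theta>)) (at (?c \<theta>) within range ?c)"
      by (rule has_derivative_subset[OF \<Phi>'(1)]) auto
    ultimately have "((\<lambda>\<theta>. \<Phi> (?c \<theta>)) has_derivative (\<lambda>h. \<Phi>' (?c \<theta>) (- h, 0, 0))) (at \<theta>)"
      by (rule has_derivative_in_compose)
    moreover have "\<Phi>' (?c \<theta>) (- h, 0, 0) = h *\<^sub>R \<Phi>1 (?c \<theta>)" for h
    proof -
      have "linear (\<Phi>' (?c \<theta>))"
        by (rule has_derivative_linear[OF \<Phi>'(1)]) auto
      from linear_cmul[OF this, of h "(- 1, 0, 0)"] show ?thesis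
        by (simp add: \<Phi>1_def)
    qed
    ultimately have "((\<lambda>\<theta>. \<Phi> (?c \<theta>)) has_derivative (\<lambda>h. h *\<^sub>R \<Phi>1 (?c \<theta>))) (at \<theta>)"
      by simp
    from has_derivative_inner_right[OF this, of "z \<tau>"] show ?thesis
      by (simp add: has_field_derivative_def mult_commute_abs)
  qed
  have "(melnikov T z x \<Phi> has_real_derivative melnikov T z x \<Phi>1 \<theta>) (at \<theta>)" for \<theta>
  proof -
    have "((\<lambda>\<theta>. integral (cbox 0 T) (\<lambda>\<tau>. z \<tau> \<bullet> \<Phi> (\<tau> - \<theta>, x \<tau>, 0))) has_real_derivative
        integral (cbox 0 T) (\<lambda>\<tau>. z \<tau> \<bullet> \<Phi>1 (\<tau> - \<theta>, x \<tau>, 0))) (at \<theta> within UNIV)"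
    proof (rule leibniz_rule_field_derivative)
      show "(\<lambda>\<tau>. z \<tau> \<bullet> \<Phi> (\<tau> - \<theta>, x \<tau>, 0)) integrable_on cbox 0 T" for \<theta>
      proof -
        have "continuous_on {0..T} (\<lambda>\<tau>. (\<theta>, \<tau>))"
          by (intro continuous_intros)
        from continuous_on_compose2[OF cont[OF \<Phi>] this] show ?thesis
          by (auto intro!: integrable_continuous_real)
      qed
      show "continuous_on (UNIV \<times> cbox 0 T) (\<lambda>(\<theta>, \<tau>). z \<tau> \<bullet> \<Phi>1 (\<tau> - \<theta>, x \<tau>, 0))"
        using cont[OF C1] by (simp add: case_prod_beta)
    qed (use der in auto)
    then show ?thesis
      by (simp add: melnikov_def[abs_def])
  qed
  then show thesis
    using that C1 by blast
qed

lemma iterated_deriv_eqI: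
  fixes h :: "nat \<Rightarrow> real \<Rightarrow> real"
  assumes "\<And>m x. m < n \<Longrightarrow> (h m has_real_derivative h (Suc m) x) (at x)"
  shows "m \<le> n \<Longrightarrow> (deriv ^^ m) (h 0) = h m"
proof (induction m)
  case (Suc m)
  then show ?case
    using assms[of m] by (auto intro!: ext DERIV_imp_deriv)
qed simp

text \<open>
  Taylor's formula reads \<open>f x = f'' t / 2 * (x - a)\<^sup>2\<close> with \<open>t\<close> between \<open>a\<close> and \<open>x\<close>, and
  \<open>f''\<close> changes sign at \<open>a\<close> because its derivative there is nonzero.
\<close>

lemma third_order_zero_sign:
  fixes f :: "real \<Rightarrow> real"
  assumes der: "\<And>m x. m < 3 \<Longrightarrow> ((deriv ^^ m) f has_real_derivative (deriv ^^ Suc m) f x) (at x)"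
    and zero: "f a = 0" "deriv f a = 0" "(deriv ^^ 2) f a = 0"
    and nz: "(deriv ^^ 3) f a \<noteq> 0"
  obtains d where "d > 0"
    and "\<And>x. 0 < \<bar>x - a\<bar> \<Longrightarrow> \<bar>x - a\<bar> < d \<Longrightarrow> (deriv ^^ 3) f a * f x * (x - a) > 0"
proof -
  define c where "c = (deriv ^^ 3) f a"
  have "((\<lambda>x. c * (deriv ^^ 2) f x) has_real_derivative c * c) (at a)"
    using der[of 2 a] unfolding c_def by (auto intro!: derivative_eq_intros simp: numeral_3_eq_3 numeral_2_eq_2)
  moreover have "c * c > 0"
    using nz by (simp add: c_def zero_less_mult_iff) linarith
  ultimately obtain d1 d2 where d: "d1 > 0" "\<And>h. 0 < h \<Longrightarrow> h < d1 \<Longrightarrow> c * (deriv ^^ 2) f (a + h) > 0"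
    "d2 > 0" "\<And>h. 0 < h \<Longrightarrow> h < d2 \<Longrightarrow> c * (deriv ^^ 2) f (a - h) < 0"
    using DERIV_pos_inc_right[of "\<lambda>x. c * (deriv ^^ 2) f x" "c * c" a]
      DERIV_pos_inc_left[of "\<lambda>x. c * (deriv ^^ 2) f x" "c * c" a] zero(3)
    by (metis mult_zero_right)
  show thesis
  proof
    show "min d1 d2 > 0"
      using d by simp
    fix x assume x: "0 < \<bar>x - a\<bar>" "\<bar>x - a\<bar> < min d1 d2"
    have "\<exists>t. (if x < a then x < t \<and> t < a else a < t \<and> t < x) \<and>
        f x = (\<Sum>m<2. ((deriv ^^ m) f a / fact m) * (x - a) ^ m) + ((deriv ^^ 2) f t / fact 2) * (x - a) ^ 2"
      by (rule Taylor[of 2 "\<lambda>m. (deriv ^^ m) f" f "min x a" "max x a"]) (use x der in auto)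
    then obtain t where t: "if x < a then x < t \<and> t < a else a < t \<and> t < x"
      "f x = (\<Sum>m<2. ((deriv ^^ m) f a / fact m) * (x - a) ^ m) + ((deriv ^^ 2) f t / fact 2) * (x - a) ^ 2"
      by blast
    then have fx: "f x = (deriv ^^ 2) f t / 2 * (x - a)\<^sup>2"
      using zero by (simp add: numeral_2_eq_2)
    have "c * (deriv ^^ 2) f t * (x - a) > 0"
    proof (cases "x < a")
      case True
      then show ?thesis
        using d(4)[of "a - t"] t(1) x by (auto simp: mult_neg_neg)
    next
      case False
      then show ?thesis
        using d(2)[of "t - a"] t(1) x by auto
    qed
    then have "c * (deriv ^^ 2) f t * (x - a) * ((x - a)\<^sup>2 / 2) > 0"
      by (rule mult_pos_pos) (use x(1) in auto)
    then show "(deriv ^^ 3) f a * f x * (x - a) > 0"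
      unfolding fx c_def[symmetric] by (simp add: mult_ac)
  qed
qed

section \<open>Solving the bifurcation equation\<close>

text \<open>
  Lyapunov--Schmidt reduction without derivatives. Adding \<open>\<langle>\<zeta>, w\<rangle> \<zeta>\<close> turns the singular map \<open>B\<close> into
  an invertible one, and \<open>G \<epsilon> \<theta> w = 0\<close> follows from \<open>G \<epsilon> \<theta> w + \<langle>\<zeta>, w\<rangle> \<zeta> = 0\<close> together with
  \<open>\<langle>\<zeta>, G \<epsilon> \<theta> w\<rangle> = 0\<close>. The first equation is a fixed-point equation in \<open>w\<close> with values in a fixed ball,
  the second is a scalar equation in \<open>\<theta>\<close> whose left side has opposite signs at the ends of a short
  interval. Both are solved together by Brouwer's theorem on the product of interval and ball.
\<close>

lemma reduced_equation_has_zeros: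
  fixes G :: "real \<Rightarrow> real \<Rightarrow> 'a::euclidean_space \<Rightarrow> 'a"
  assumes cont: "continuous_on ({0..1} \<times> {\<theta>0 - 1..\<theta>0 + 1} \<times> UNIV) (\<lambda>(\<epsilon>, \<theta>, w). G \<epsilon> \<theta> w)"
    and G0: "\<And>\<theta> w. \<theta> \<in> {\<theta>0 - 1..\<theta>0 + 1} \<Longrightarrow> G 0 \<theta> w = B w + c \<theta>"
    and B: "linear B" "\<And>w. \<zeta> \<bullet> B w = 0" "\<And>w. B w = 0 \<Longrightarrow> \<zeta> \<bullet> w = 0 \<Longrightarrow> w = 0"
    and sign: "\<delta>0 > 0" "\<And>\<theta>. 0 < \<bar>\<theta> - \<theta>0\<bar> \<Longrightarrow> \<bar>\<theta> - \<theta>0\<bar> < \<delta>0 \<Longrightarrow> k * (\<zeta> \<bullet> c \<theta>) * (\<theta> - \<theta>0) > 0"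
  obtains R where "\<And>\<delta>. \<delta> > 0 \<Longrightarrow>
    \<forall>\<^sub>F \<epsilon> in at_right 0. \<exists>\<theta> w. \<bar>\<theta> - \<theta>0\<bar> < \<delta> \<and> \<bar>\<theta> - \<theta>0\<bar> \<le> 1 \<and> norm w \<le> R \<and> G \<epsilon> \<theta> w = 0"
proof -
  define I where "I = {\<theta>0 - 1..\<theta>0 + 1}"
  have "\<zeta> \<noteq> 0" "k \<noteq> 0"
    using sign(2)[of "\<theta>0 + \<delta>0 / 2"] sign(1) by auto
  define K where "K w = B w + (\<zeta> \<bullet> w) *\<^sub>R \<zeta>" for w
  have linK: "linear K"
    unfolding K_def
    by (intro linear_compose_add B(1)) (auto intro!: linearI simp: inner_add_right algebra_simps)
  have "inj K"
  proof (subst linear_injective_0[OF linK], safe)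
    fix w assume "K w = 0"
    then have "\<zeta> \<bullet> K w = 0"
      by simp
    then have "\<zeta> \<bullet> w = 0"
      using \<open>\<zeta> \<noteq> 0\<close> B(2) by (simp add: K_def inner_add_right)
    then show "w = 0"
      using \<open>K w = 0\<close> B(3) by (simp add: K_def)
  qed
  then obtain Ki where Ki: "linear Ki" "\<And>w. Ki (K w) = w" "\<And>w. K (Ki w) = w"
    using linear_injective_isomorphism[OF linK] by blast
  obtain \<kappa> where \<kappa>: "\<kappa> > 0" "\<And>w. norm (Ki w) \<le> \<kappa> * norm w"
    using linear_bounded_pos[OF Ki(1)] by blast
  have contG: "continuous_on S (\<lambda>p. G (f p) (g p) (h p))"
    if "continuous_on S f" "continuous_on S g" "continuous_on S h"
       "\<And>p. p \<in> S \<Longrightarrow> f p \<in> {0..1} \<and> g p \<in> I"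
    for S :: "'b::topological_space set" and f g h
    using continuous_on_compose2[OF cont, of S "\<lambda>p. (f p, g p, h p)"] that
    by (fastforce simp: I_def intro!: continuous_intros)
  have contKi: "continuous_on S (\<lambda>p. Ki (f p))" if "continuous_on S f"
    for S :: "'b::topological_space set" and f
    using continuous_on_compose2[OF linear_continuous_on that, of Ki UNIV] Ki(1)
    by (simp add: linear_conv_bounded_linear)
  have B0: "B 0 = 0"
    using B(1) by (rule linear_0)
  have "continuous_on I (\<lambda>\<theta>. Ki (G 0 \<theta> 0))"
    by (intro contKi contG continuous_intros) auto
  then have "bounded ((\<lambda>\<theta>. Ki (G 0 \<theta> 0)) ` I)"
    by (intro compact_imp_bounded compact_continuous_image) (auto simp: I_def)
  then obtain R0 where R0: "R0 > 0" "\<And>\<theta>. \<theta> \<in> I \<Longrightarrow> norm (Ki (G 0 \<theta> 0)) \<le> R0"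
    unfolding bounded_pos by auto
  have Kic: "norm (Ki (c \<theta>)) \<le> R0" if "\<theta> \<in> I" for \<theta>
    using R0(2)[OF that] G0[of \<theta> 0] that by (simp add: I_def B0)
  \<comment> \<open>The extra \<open>1\<close> absorbs the deviation of \<open>G \<epsilon>\<close> from \<open>G 0\<close>.\<close>
  define R where "R = R0 + 1"
  have "\<forall>\<^sub>F \<epsilon> in at_right 0. \<exists>\<theta> w. \<bar>\<theta> - \<theta>0\<bar> < \<delta> \<and> \<bar>\<theta> - \<theta>0\<bar> \<le> 1 \<and> norm w \<le> R \<and> G \<epsilon> \<theta> w = 0"
    if "\<delta> > 0" for \<delta>
  proof -
    define \<eta> where "\<eta> = min (\<delta> / 2) (min (\<delta>0 / 2) 1)"
    have \<eta>: "\<eta> > 0" "\<eta> < \<delta>" "\<eta> < \<delta>0" "\<eta> \<le> 1"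
      using that sign(1) by (auto simp: \<eta>_def)
    define m where "m = min (k * (\<zeta> \<bullet> c (\<theta>0 + \<eta>))) (- (k * (\<zeta> \<bullet> c (\<theta>0 - \<eta>))))"
    have m: "m > 0" "k * (\<zeta> \<bullet> c (\<theta>0 + \<eta>)) \<ge> m" "k * (\<zeta> \<bullet> c (\<theta>0 - \<eta>)) \<le> - m"
      using sign(2)[of "\<theta>0 + \<eta>"] sign(2)[of "\<theta>0 - \<eta>"] \<eta>
      by (auto simp: m_def zero_less_mult_iff mult_less_0_iff)
    \<comment> \<open>So small that neither the signs at the end points nor the bound \<open>R\<close> can be violated when
      \<open>G \<epsilon>\<close> deviates from \<open>G 0\<close> by at most \<open>e\<close>.\<close>
    define e where "e = min (1 / \<kappa>) (m / (2 * \<bar>k\<bar> * norm \<zeta>))"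
    have e: "e > 0" "\<kappa> * e \<le> 1" "\<bar>k\<bar> * norm \<zeta> * e < m"
    proof -
      show "e > 0"
        using \<kappa>(1) m(1) \<open>\<zeta> \<noteq> 0\<close> \<open>k \<noteq> 0\<close> by (simp add: e_def)
      have "\<kappa> * e \<le> \<kappa> * (1 / \<kappa>)"
        using \<kappa>(1) by (intro mult_left_mono) (auto simp: e_def)
      then show "\<kappa> * e \<le> 1"
        using \<kappa>(1) by simp
      have "\<bar>k\<bar> * norm \<zeta> * e \<le> \<bar>k\<bar> * norm \<zeta> * (m / (2 * \<bar>k\<bar> * norm \<zeta>))"
        by (intro mult_left_mono) (auto simp: e_def)
      also have "\<dots> < m"
        using m(1) \<open>\<zeta> \<noteq> 0\<close> \<open>k \<noteq> 0\<close> by simp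
      finally show "\<bar>k\<bar> * norm \<zeta> * e < m" .
    qed
    define S where "S = {\<theta>0 - \<eta>..\<theta>0 + \<eta>} \<times> cball (0::'a) R"
    have SI: "\<theta> \<in> I" if "(\<theta>, w) \<in> S" for \<theta> w
      using that \<eta> by (auto simp: S_def I_def)
    have "continuous_on ({0..1} \<times> S) (\<lambda>p. G (fst p) (fst (snd p)) (snd (snd p)))"
      by (intro contG continuous_intros) (auto dest: SI)
    then obtain X where X: "0 \<in> X" "open X"
      "\<forall>\<epsilon>\<in>X \<inter> {0..1}. \<forall>p\<in>S. dist (G (fst (\<epsilon>, p)) (fst (snd (\<epsilon>, p))) (snd (snd (\<epsilon>, p))))
        (G (fst (0, p)) (fst (snd (0::real, p))) (snd (snd (0::real, p)))) \<le> e"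
      by (rule continuous_on_prod_compactE[where ?x0.0 = 0])
        (use e(1) in \<open>auto simp: S_def intro!: compact_Times\<close>)
    have "\<forall>\<^sub>F \<epsilon> in at_right 0. \<epsilon> \<in> X \<and> \<epsilon> \<in> {0<..<1::real}"
      using X(1,2) eventually_at_right_real[of 0 1]
      by (intro eventually_conj) (auto simp: eventually_at_topological)
    then show ?thesis
    proof eventually_elim
      case (elim \<epsilon>)
      have near: "norm (G \<epsilon> \<theta> w - (B w + c \<theta>)) \<le> e" if "(\<theta>, w) \<in> S" for \<theta> w
        using X(3) elim that G0[of \<theta> w] SI[OF that] by (force simp: dist_norm I_def)
      define b where "b \<theta> w = w - Ki (G \<epsilon> \<theta> w + (\<zeta> \<bullet> w) *\<^sub>R \<zeta>)" for \<theta> w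
      \<comment> \<open>Both components are projected back, so that \<open>h\<close> maps \<open>S\<close> to itself; it remains to see that
        the projections do not act at a fixed point.\<close>
      define h where "h p = (max (\<theta>0 - \<eta>) (min (\<theta>0 + \<eta>) (fst p - k * (\<zeta> \<bullet> G \<epsilon> (fst p) (snd p)))),
        closest_point (cball 0 R) (b (fst p) (snd p)))" for p
      have "R > 0"
        using R0(1) by (simp add: R_def)
      have conth: "continuous_on S h"
        unfolding h_def b_def using elim \<open>R > 0\<close>
        by (intro continuous_intros contKi contG continuous_on_compose2[OF continuous_on_closest_point[of "cball 0 R" UNIV]])
          (auto dest: SI)
      have "closest_point (cball 0 R) v \<in> cball 0 R" for v :: 'a
        using \<open>R > 0\<close> by (intro closest_point_in_set) auto
      then have hS: "h \<in> S \<rightarrow> S"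
        using \<eta>(1) unfolding h_def S_def by auto
      have "compact S" "convex S" "S \<noteq> {}"
        using \<eta>(1) \<open>R > 0\<close> unfolding S_def by (auto intro!: compact_Times convex_Times)
      then obtain p where p: "p \<in> S" "h p = p"
        using brouwer[OF _ _ _ conth hS] by blast
      obtain \<theta> w where [simp]: "p = (\<theta>, w)"
        by (cases p)
      have S: "(\<theta>, w) \<in> S"
        using p by simp
      have "b \<theta> w = - Ki (c \<theta>) - Ki (G \<epsilon> \<theta> w - (B w + c \<theta>))"
      proof -
        have "G \<epsilon> \<theta> w + (\<zeta> \<bullet> w) *\<^sub>R \<zeta> = K w + c \<theta> + (G \<epsilon> \<theta> w - (B w + c \<theta>))"
          by (simp add: K_def)
        then show ?thesis
          unfolding b_def by (simp only: linear_add[OF Ki(1)] Ki(2)) simp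
      qed
      then have "norm (b \<theta> w) \<le> norm (Ki (c \<theta>)) + norm (Ki (G \<epsilon> \<theta> w - (B w + c \<theta>)))"
        by (metis norm_minus_cancel norm_triangle_ineq4)
      also have "\<dots> \<le> R0 + \<kappa> * e"
        using near[OF S] \<kappa>(1)
        by (intro add_mono Kic[OF SI[OF S]] order_trans[OF \<kappa>(2)] mult_left_mono) auto
      finally have "b \<theta> w \<in> cball 0 R"
        using e(2) by (simp add: R_def)
      then have "b \<theta> w = w"
        using p by (simp add: h_def closest_point_self)
      then have "Ki (G \<epsilon> \<theta> w + (\<zeta> \<bullet> w) *\<^sub>R \<zeta>) = 0"
        by (simp add: b_def)
      then have w: "G \<epsilon> \<theta> w + (\<zeta> \<bullet> w) *\<^sub>R \<zeta> = 0"
        using Ki(3) linear_0[OF linK] by metis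
      define a where "a = k * (\<zeta> \<bullet> G \<epsilon> \<theta> w)"
      have \<theta>: "max (\<theta>0 - \<eta>) (min (\<theta>0 + \<eta>) (\<theta> - a)) = \<theta>"
        using p by (simp add: h_def a_def)
      have "\<bar>a - k * (\<zeta> \<bullet> c \<theta>)\<bar> < m"
      proof -
        have "a - k * (\<zeta> \<bullet> c \<theta>) = k * (\<zeta> \<bullet> (G \<epsilon> \<theta> w - (B w + c \<theta>)))"
          by (simp add: a_def B(2) inner_diff_right inner_add_right algebra_simps)
        also have "\<bar>\<dots>\<bar> \<le> \<bar>k\<bar> * (norm \<zeta> * norm (G \<epsilon> \<theta> w - (B w + c \<theta>)))"
          by (simp add: abs_mult mult_left_mono Cauchy_Schwarz_ineq2)
        also have "\<dots> \<le> \<bar>k\<bar> * (norm \<zeta> * e)"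
          using near[OF S] by (intro mult_left_mono) auto
        finally show ?thesis
          using e(3) by (simp add: mult.assoc)
      qed
      \<comment> \<open>If \<open>a\<close> were nonzero, the projection would have acted and \<open>\<theta>\<close> would be an end point, where
        \<open>a\<close> has the opposite sign.\<close>
      moreover have "\<theta> = \<theta>0 - \<eta>" if "a > 0"
        using \<theta> that \<eta>(1) by (auto simp: max_def min_def split: if_splits)
      moreover have "\<theta> = \<theta>0 + \<eta>" if "a < 0"
        using \<theta> that \<eta>(1) by (auto simp: max_def min_def split: if_splits)
      ultimately have "a = 0"
        using m by (cases a "0::real" rule: linorder_cases) auto
      then have "\<zeta> \<bullet> G \<epsilon> \<theta> w = 0"
        using \<open>k \<noteq> 0\<close> by (simp add: a_def)
      moreover have "\<zeta> \<bullet> (G \<epsilon> \<theta> w + (\<zeta> \<bullet> w) *\<^sub>R \<zeta>) = 0"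
        by (simp add: w)
      ultimately have "\<zeta> \<bullet> w = 0"
        using \<open>\<zeta> \<noteq> 0\<close> by (simp add: inner_add_right)
      then have "G \<epsilon> \<theta> w = 0"
        using w by simp
      then show ?case
        using S \<eta> by (intro exI[of _ \<theta>] exI[of _ w]) (auto simp: S_def)
    qed
  qed
  then show thesis
    by (rule that)
qed

text \<open>
  A choice of \<open>s \<epsilon>\<close> that serves all tolerances \<open>\<delta>\<close> at once: take a point at which \<open>e \<epsilon>\<close> comes within
  \<open>\<epsilon>\<close> of its infimum.
\<close>

lemma eventually_at_right_selection:
  fixes e :: "real \<Rightarrow> 'a \<Rightarrow> real"
  assumes nonneg: "\<And>\<epsilon> x. e \<epsilon> x \<ge> 0"
    and ex: "\<And>\<delta>. \<delta> > 0 \<Longrightarrow> \<forall>\<^sub>F \<epsilon> in at_right 0. \<exists>x. P \<epsilon> x \<and> e \<epsilon> x < \<delta>"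
  obtains s where "\<forall>\<^sub>F \<epsilon> in at_right 0. P \<epsilon> (s \<epsilon>)"
    and "((\<lambda>\<epsilon>. e \<epsilon> (s \<epsilon>)) \<longlongrightarrow> 0) (at_right 0)"
proof -
  define m where "m \<epsilon> = (INF x\<in>Collect (P \<epsilon>). e \<epsilon> x)" for \<epsilon>
  define s where "s \<epsilon> = (SOME x. P \<epsilon> x \<and> e \<epsilon> x < m \<epsilon> + \<epsilon>)" for \<epsilon>
  have bdd: "bdd_below (e \<epsilon> ` Collect (P \<epsilon>))" for \<epsilon>
    using nonneg by (auto simp: bdd_below_def)
  have s: "P \<epsilon> (s \<epsilon>) \<and> e \<epsilon> (s \<epsilon>) < m \<epsilon> + \<epsilon>" if "\<epsilon> > 0" "P \<epsilon> x" for \<epsilon> x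
  proof -
    have "(INF x\<in>Collect (P \<epsilon>). e \<epsilon> x) < m \<epsilon> + \<epsilon>"
      using that(1) by (simp add: m_def)
    then have "\<exists>x\<in>Collect (P \<epsilon>). e \<epsilon> x < m \<epsilon> + \<epsilon>"
      using bdd that(2) by (subst (asm) cINF_less_iff) auto
    then show ?thesis
      unfolding s_def by (intro someI_ex[of "\<lambda>x. P \<epsilon> x \<and> e \<epsilon> x < m \<epsilon> + \<epsilon>"]) auto
  qed
  have small: "\<forall>\<^sub>F \<epsilon> in at_right 0. P \<epsilon> (s \<epsilon>) \<and> e \<epsilon> (s \<epsilon>) < \<delta>" if "\<delta> > 0" for \<delta>
  proof -
    have "\<forall>\<^sub>F \<epsilon> in at_right 0. \<epsilon> \<in> {0<..<\<delta> / 2}"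
      using that by (intro eventually_at_right_real) simp
    moreover have "\<forall>\<^sub>F \<epsilon> in at_right 0. \<exists>x. P \<epsilon> x \<and> e \<epsilon> x < \<delta> / 2"
      using that by (intro ex) simp
    ultimately show ?thesis
    proof eventually_elim
      case (elim \<epsilon>)
      then obtain x where x: "P \<epsilon> x" "e \<epsilon> x < \<delta> / 2"
        by blast
      have "m \<epsilon> \<le> e \<epsilon> x"
        unfolding m_def using x(1) bdd by (intro cINF_lower) auto
      then show ?case
        using s[of \<epsilon> x] x elim by auto
    qed
  qed
  show thesis
  proof
    show "\<forall>\<^sub>F \<epsilon> in at_right 0. P \<epsilon> (s \<epsilon>)"
      using small[of 1] by (auto elim: eventually_mono)
    show "((\<lambda>\<epsilon>. e \<epsilon> (s \<epsilon>)) \<longlongrightarrow> 0) (at_right 0)"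
      by (intro tendstoI eventually_mono[OF small]) (auto simp: nonneg)
  qed
qed

section \<open>Periodic solutions near a nondegenerate cycle\<close>

theorem corollary3p6:
  fixes T \<theta>0 :: real
    and \<psi> :: "real ^ 'n \<Rightarrow> real ^ 'n"
    and \<phi> :: "real \<Rightarrow> real ^ 'n \<Rightarrow> real \<Rightarrow> real ^ 'n"
    and x0 z0 :: "real \<Rightarrow> real ^ 'n"
  assumes "T > 0"
    and "C_on 1 UNIV \<psi>"
    and "C_on 3 (UNIV \<times> UNIV \<times> {0..1}) (\<lambda>(t, x, \<epsilon>). \<phi> t x \<epsilon>)"
    and "\<forall>t x. \<forall>\<epsilon>\<in>{0..1}. \<phi> (t + T) x \<epsilon> = \<phi> t x \<epsilon>"
    and "nondegenerate_limit_cycle T \<psi> x0"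
    and "adjoint_solution T \<psi> x0 z0"
    and "\<theta>0 \<in> {0..T}"
    and "malkin T \<phi> x0 z0 \<theta>0 = 0"
    and "deriv (malkin T \<phi> x0 z0) \<theta>0 = 0"
    and "(deriv ^^ 2) (malkin T \<phi> x0 z0) \<theta>0 = 0"
    and "(deriv ^^ 3) (malkin T \<phi> x0 z0) \<theta>0 \<noteq> 0"
  shows "\<exists>x :: real \<Rightarrow> real \<Rightarrow> real ^ 'n.
           (\<forall>\<^sub>F \<epsilon> in at_right 0. periodic_solution T (\<lambda>t y. \<psi> y + \<epsilon> *\<^sub>R \<phi> t y \<epsilon>) (x \<epsilon>)) \<and>
           (\<forall>t\<in>{0..T}. ((\<lambda>\<epsilon>. x \<epsilon> t) \<longlongrightarrow> x0 (t + \<theta>0)) (at_right 0))"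
proof -
  note T = assms(1)
  define \<Phi> where "\<Phi> = (\<lambda>(t, x, \<epsilon>). \<phi> t x \<epsilon>)"
  have \<Phi>: "C_on (Suc (Suc (Suc 0))) (UNIV \<times> UNIV \<times> {0..1}) \<Phi>"
    using assms(3) by (simp only: \<Phi>_def numeral_3_eq_3)
  have \<Phi>_app: "\<Phi> (t, v, \<epsilon>) = \<phi> t v \<epsilon>" for t v \<epsilon>
    by (simp add: \<Phi>_def)
  obtain D where der: "\<And>y. (\<psi> has_derivative D y) (at y)"
    and contD: "\<And>v. continuous_on UNIV (\<lambda>y. D y v)"
    using assms(2) unfolding One_nat_def C_on.simps by auto
  define A where "A t = jacobian \<psi> (at (x0 t))" for t
  have A: "A t *v v = D (x0 t) v" for t v
  proof -
    have "frechet_derivative \<psi> (at (x0 t)) = D (x0 t)"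
      using frechet_derivative_at[OF der] by simp
    then show ?thesis
      using matrix_vector_mul(2)[OF has_derivative_linear[OF der], THEN fun_cong]
      by (simp add: A_def jacobian_def)
  qed
  have x0_sol: "periodic_solution T (\<lambda>t. \<psi>) x0"
    using assms(5) by (simp add: nondegenerate_limit_cycle_def)
  have x0_der: "(x0 has_vector_derivative \<psi> (x0 t)) (at t)" for t
    using periodic_solution_has_vector_derivative[OF T x0_sol] by simp
  have x0_per: "x0 (t + T) = x0 t" for t
    using x0_sol by (auto simp: periodic_solution_def)
  have x0_cont: "continuous_on S x0" for S
    by (rule continuous_on_vector_derivative[OF has_vector_derivative_at_within[OF x0_der]])
  \<comment> \<open>The monodromy matrix is \<open>M = Y T\<close>.\<close>
  obtain Y where Y_der: "\<And>t. t \<in> {0..T} \<Longrightarrow> (Y has_vector_derivative A t ** Y t) (at t within {0..T})"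
    and Y0: "Y 0 = mat 1" and ord: "order 1 (charpoly (Y T)) = 1"
    using assms(5) unfolding nondegenerate_limit_cycle_def floquet_multiplier_def monodromy_matrix_def A_def
    by blast
  have Y_app_der: "((\<lambda>t. Y t *v w) has_vector_derivative A t *v (Y t *v w)) (at t within {0..T})"
    if "t \<in> {0..T}" for t w
  proof -
    have "linear (\<lambda>B :: real ^ 'n ^ 'n. B *v w)"
      by (rule linearI)
        (simp_all add: vec_eq_iff matrix_vector_mult_def algebra_simps sum.distrib sum_distrib_left)
    then have "bounded_linear (\<lambda>B :: real ^ 'n ^ 'n. B *v w)"
      by (simp add: linear_conv_bounded_linear)
    from bounded_linear.has_vector_derivative[OF this Y_der[OF that]] show ?thesis
      by (simp add: matrix_vector_mul_assoc)
  qed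
  have z0_der: "(z0 has_vector_derivative - (transpose (A t) *v z0 t)) (at t within {0..T})"
    if "t \<in> {0..T}" for t
    using assms(6) that by (simp add: adjoint_solution_def periodic_solution_def A_def)
  have z0_T: "z0 T = z0 0"
    using assms(6) by (simp add: adjoint_solution_def periodic_solution_def)
  have z0_cont: "continuous_on {0..T} z0"
    using z0_der by (rule continuous_on_vector_derivative)
  obtain L where L: "\<And>t v. t \<in> {0..T} \<Longrightarrow> norm (A t *v v) \<le> L * norm v"
  proof -
    have "bounded (x0 ` {0..T})"
      by (intro compact_imp_bounded compact_continuous_image x0_cont) auto
    then obtain a where a: "x0 ` {0..T} \<subseteq> cball 0 a"
      by (auto simp: bounded_iff image_subset_iff)
    have "\<exists>L. \<forall>y\<in>cball 0 a. \<forall>v. norm (D y v) \<le> L * norm v"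
    proof (rule lipschitz_on_compact_convex[of UNIV \<psi> D "cball 0 a"])
      fix L assume "\<And>y v. y \<in> cball 0 a \<Longrightarrow> norm (D y v) \<le> L * norm v"
      then show "\<exists>L. \<forall>y\<in>cball 0 a. \<forall>v. norm (D y v) \<le> L * norm v"
        by blast
    qed (simp_all add: der contD)
    then obtain L where "\<And>y v. y \<in> cball 0 a \<Longrightarrow> norm (D y v) \<le> L * norm v"
      by blast
    with a show thesis
      by (intro that[of L]) (simp add: A image_subset_iff)
  qed
  have unique: "d t = 0" if "\<And>t. t \<in> {0..T} \<Longrightarrow> (d has_vector_derivative A t *v d t) (at t within {0..T})"
    "d 0 = 0" "t \<in> {0..T}" for d t
    using linear_ode_zero[of T d "\<lambda>t. (*v) (A t)" L] that L by blast
  define v0 where "v0 = \<psi> (x0 0)"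
  \<comment> \<open>The velocity of the cycle solves the linearized equation and is periodic.\<close>
  have v0: "Y T *v v0 = v0"
  proof -
    let ?d = "\<lambda>t. \<psi> (x0 t) - Y t *v v0"
    have "?d T = 0"
    proof (rule unique)
      show "(?d has_vector_derivative A t *v ?d t) (at t within {0..T})" if t: "t \<in> {0..T}" for t
      proof -
        have "((\<lambda>t. \<psi> (x0 t)) has_vector_derivative A t *v \<psi> (x0 t)) (at t within {0..T})"
          using vector_derivative_diff_chain_within[OF
              has_vector_derivative_at_within[OF x0_der] has_derivative_at_withinI[OF der]]
          by (simp add: A o_def)
        from has_vector_derivative_diff[OF this Y_app_der[OF t]] show ?thesis
          by (simp add: matrix_vector_mult_diff_distrib)
      qed
      show "?d 0 = 0"
        by (simp add: v0_def Y0)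
    qed (use T in auto)
    then show ?thesis
      using x0_per[of 0] by (simp add: v0_def)
  qed
  define \<zeta> where "\<zeta> = z0 0"
  define \<sigma> where "\<sigma> = sgn (v0 \<bullet> \<zeta>)"
  define J where "J = melnikov T z0 x0 \<Phi>"
  have malkin: "malkin T \<phi> x0 z0 = (\<lambda>\<theta>. \<sigma> * J \<theta>)"
    using vector_derivative_at[OF x0_der[of 0]]
    by (simp add: fun_eq_iff malkin_def \<sigma>_def v0_def \<zeta>_def J_def melnikov_def \<Phi>_app)
  obtain \<Phi>1 where \<Phi>1: "C_on (Suc (Suc 0)) (UNIV \<times> UNIV \<times> {0..1}) \<Phi>1"
    "\<And>\<theta>. (J has_real_derivative melnikov T z0 x0 \<Phi>1 \<theta>) (at \<theta>)"
    unfolding J_def using melnikov_has_derivative[OF z0_cont x0_cont \<Phi>] by blast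
  obtain \<Phi>2 where \<Phi>2: "C_on (Suc 0) (UNIV \<times> UNIV \<times> {0..1}) \<Phi>2"
    "\<And>\<theta>. (melnikov T z0 x0 \<Phi>1 has_real_derivative melnikov T z0 x0 \<Phi>2 \<theta>) (at \<theta>)"
    using melnikov_has_derivative[OF z0_cont x0_cont \<Phi>1(1)] by blast
  obtain \<Phi>3 where \<Phi>3:
    "\<And>\<theta>. (melnikov T z0 x0 \<Phi>2 has_real_derivative melnikov T z0 x0 \<Phi>3 \<theta>) (at \<theta>)"
    using melnikov_has_derivative[OF z0_cont x0_cont \<Phi>2(1)] by blast
  \<comment> \<open>\<open>deriv\<close> of a function that is not differentiable is arbitrary, so the iterated derivatives
    have to be identified with derivatives that are known to exist.\<close>
  define h where "h m \<theta> = \<sigma> * (if m = 0 then J \<theta> else if m = 1 then melnikov T z0 x0 \<Phi>1 \<theta>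
    else if m = 2 then melnikov T z0 x0 \<Phi>2 \<theta> else melnikov T z0 x0 \<Phi>3 \<theta>)" for m :: nat and \<theta>
  have h: "(h m has_real_derivative h (Suc m) \<theta>) (at \<theta>)" if "m < 3" for m \<theta>
  proof -
    have "m = 0 \<or> m = 1 \<or> m = 2"
      using that by linarith
    then show ?thesis
      by (elim disjE) (auto simp: h_def[abs_def] intro!: DERIV_cmult \<Phi>1(2) \<Phi>2(2) \<Phi>3)
  qed
  have derivs: "(deriv ^^ m) (malkin T \<phi> x0 z0) = h m" if "m \<le> 3" for m
    using iterated_deriv_eqI[of 3 h, OF h that] by (simp add: malkin h_def[abs_def])
  \<comment> \<open>A vanishing sign factor would make the bifurcation function zero.\<close>
  have "\<sigma> \<noteq> 0"
    using assms(11) derivs[of 3] by (auto simp: h_def)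
  then have v0\<zeta>: "v0 \<bullet> \<zeta> \<noteq> 0"
    by (auto simp: \<sigma>_def)
  have malkin_der: "((deriv ^^ m) (malkin T \<phi> x0 z0) has_real_derivative
      (deriv ^^ Suc m) (malkin T \<phi> x0 z0) \<theta>) (at \<theta>)" if "m < 3" for m \<theta>
    using h[OF that] derivs[of m] derivs[of "Suc m"] that by (simp del: funpow.simps)
  obtain \<delta>0 where \<delta>0: "\<delta>0 > 0" "\<And>\<theta>. 0 < \<bar>\<theta> - \<theta>0\<bar> \<Longrightarrow> \<bar>\<theta> - \<theta>0\<bar> < \<delta>0 \<Longrightarrow>
      (deriv ^^ 3) (malkin T \<phi> x0 z0) \<theta>0 * malkin T \<phi> x0 z0 \<theta> * (\<theta> - \<theta>0) > 0"
    using third_order_zero_sign[OF malkin_der assms(8-11)] by blast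
  obtain X where X0: "\<And>\<epsilon> \<theta> w. \<epsilon> \<in> {0..1} \<Longrightarrow> \<theta> \<in> {\<theta>0 - 1..\<theta>0 + 1} \<Longrightarrow> X \<epsilon> \<theta> w 0 = w"
    and X_lin: "\<And>\<theta> w t. \<theta> \<in> {\<theta>0 - 1..\<theta>0 + 1} \<Longrightarrow> t \<in> {0..T} \<Longrightarrow>
      (X 0 \<theta> w has_vector_derivative D (x0 t) (X 0 \<theta> w t) + \<Phi> (t - \<theta>, x0 t, 0)) (at t within {0..T})"
    and X_der: "\<And>\<epsilon> \<theta> w t. \<epsilon> \<in> {0<..1} \<Longrightarrow> \<theta> \<in> {\<theta>0 - 1..\<theta>0 + 1} \<Longrightarrow> t \<in> {0..T} \<Longrightarrow> norm (\<epsilon> *\<^sub>R X \<epsilon> \<theta> w t) \<le> 1 \<Longrightarrow>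
      (X \<epsilon> \<theta> w has_vector_derivative (1 / \<epsilon>) *\<^sub>R (\<psi> (x0 t + \<epsilon> *\<^sub>R X \<epsilon> \<theta> w t) - \<psi> (x0 t))
        + \<Phi> (t - \<theta>, x0 t + \<epsilon> *\<^sub>R X \<epsilon> \<theta> w t, \<epsilon>)) (at t within {0..T})"
    and X_cont: "continuous_on ({0..1} \<times> {\<theta>0 - 1..\<theta>0 + 1} \<times> UNIV \<times> {0..T}) (\<lambda>(\<epsilon>, \<theta>, w, t). X \<epsilon> \<theta> w t)"
    using rescaled_flow[OF T der contD \<Phi> x0_cont] by blast
  define G where "G \<epsilon> \<theta> w = X \<epsilon> \<theta> w T - w" for \<epsilon> \<theta> w
  obtain R where R: "\<And>\<delta>. \<delta> > 0 \<Longrightarrow> \<forall>\<^sub>F \<epsilon> in at_right 0.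
      \<exists>\<theta> w. \<bar>\<theta> - \<theta>0\<bar> < \<delta> \<and> \<bar>\<theta> - \<theta>0\<bar> \<le> 1 \<and> norm w \<le> R \<and> G \<epsilon> \<theta> w = 0"
  proof (rule reduced_equation_has_zeros)
    show "continuous_on ({0..1} \<times> {\<theta>0 - 1..\<theta>0 + 1} \<times> UNIV) (\<lambda>(\<epsilon>, \<theta>, w). G \<epsilon> \<theta> w)"
    proof -
      let ?Q = "{0..1} \<times> {\<theta>0 - 1..\<theta>0 + 1} \<times> (UNIV :: (real ^ 'n) set)"
      have "continuous_on ?Q (\<lambda>y. (fst y, fst (snd y), snd (snd y), T))"
        by (intro continuous_intros)
      then have "continuous_on ?Q (\<lambda>y. case (fst y, fst (snd y), snd (snd y), T) of (\<epsilon>, \<theta>, w, t) \<Rightarrow> X \<epsilon> \<theta> w t)"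
        by (rule continuous_on_compose2[OF X_cont]) (use T in auto)
      then show ?thesis
        by (auto simp: G_def case_prod_beta intro!: continuous_intros)
    qed
    \<comment> \<open>Two solutions of the inhomogeneous linear equation differ by a solution of the homogeneous
      one.\<close>
    show "G 0 \<theta> w = (Y T *v w - w) + X 0 \<theta> 0 T" if \<theta>: "\<theta> \<in> {\<theta>0 - 1..\<theta>0 + 1}" for \<theta> w
    proof -
      let ?d = "\<lambda>t. X 0 \<theta> w t - X 0 \<theta> 0 t - Y t *v w"
      have "?d T = 0"
      proof (rule unique)
        show "(?d has_vector_derivative A t *v ?d t) (at t within {0..T})" if t: "t \<in> {0..T}" for t
          using has_vector_derivative_diff[OF has_vector_derivative_diff[OF X_lin[OF \<theta> t] X_lin[OF \<theta> t]]
              Y_app_der[OF t], of w 0 w]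
          by (simp add: A[symmetric] matrix_vector_mult_diff_distrib)
        show "?d 0 = 0"
          using X0[OF _ \<theta>] by (simp add: Y0)
      qed (use T in auto)
      then show ?thesis
        by (simp add: G_def algebra_simps)
    qed
    show "linear (\<lambda>w. Y T *v w - w)"
      by (intro linear_compose_sub matrix_vector_mul_linear linear_id[unfolded id_def])
    show "\<zeta> \<bullet> (Y T *v w - w) = 0" for w
    proof -
      have "((\<lambda>t. z0 t \<bullet> 0) has_integral z0 T \<bullet> (Y T *v w) - z0 0 \<bullet> (Y 0 *v w)) {0..T}"
        by (rule adjoint_pairing[where A = A]) (use T z0_der Y_app_der in auto)
      then have "z0 T \<bullet> (Y T *v w) - z0 0 \<bullet> (Y 0 *v w) = 0"
        by (simp add: has_integral_0_eq)
      then show ?thesis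
        by (simp add: z0_T Y0 \<zeta>_def inner_diff_right)
    qed
    show "w = 0" if "Y T *v w - w = 0" "\<zeta> \<bullet> w = 0" for w
    proof -
      have "v0 \<noteq> 0" "Y T *v w = w"
        using v0\<zeta> that(1) by auto
      then obtain c where "w = c *\<^sub>R v0"
        using eigenspace_of_simple_root[OF ord v0] by blast
      then show ?thesis
        using that(2) v0\<zeta> by (auto simp: inner_commute)
    qed
    show "min \<delta>0 1 > 0"
      using \<delta>0(1) by simp
    show "((deriv ^^ 3) (malkin T \<phi> x0 z0) \<theta>0 * \<sigma>) * (\<zeta> \<bullet> X 0 \<theta> 0 T) * (\<theta> - \<theta>0) > 0"
      if "0 < \<bar>\<theta> - \<theta>0\<bar>" "\<bar>\<theta> - \<theta>0\<bar> < min \<delta>0 1" for \<theta>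
    proof -
      have \<theta>: "\<theta> \<in> {\<theta>0 - 1..\<theta>0 + 1}"
        using that(2) by auto
      have "((\<lambda>t. z0 t \<bullet> \<Phi> (t - \<theta>, x0 t, 0)) has_integral z0 T \<bullet> X 0 \<theta> 0 T - z0 0 \<bullet> X 0 \<theta> 0 0) {0..T}"
        by (rule adjoint_pairing[where A = A]) (use T z0_der X_lin[OF \<theta>] in \<open>auto simp: A\<close>)
      then have "J \<theta> = \<zeta> \<bullet> X 0 \<theta> 0 T"
        using X0[OF _ \<theta>] by (simp add: J_def melnikov_def \<zeta>_def z0_T integral_unique)
      then show ?thesis
        using \<delta>0(2)[OF that(1)] that(2) by (simp add: malkin mult_ac)
    qed
  qed (rule that)
  let ?K = "{0..1} \<times> {\<theta>0 - 1..\<theta>0 + 1} \<times> cball (0 :: real ^ 'n) R \<times> {0..T}"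
  have "bounded ((\<lambda>(\<epsilon>, \<theta>, w, t). X \<epsilon> \<theta> w t) ` ?K)"
    by (intro compact_imp_bounded compact_continuous_image continuous_on_subset[OF X_cont])
      (auto intro!: compact_Times)
  \<comment> \<open>The bound \<open>\<rho>\<close> on \<open>u\<close> is uniform; for \<open>\<epsilon> \<rho> \<le> 1\<close> it keeps \<open>\<epsilon> u\<close> in the region where the
    rescaled flow solves the true equation.\<close>
  then obtain \<rho> where \<rho>: "\<rho> > 0" "\<And>p. p \<in> ?K \<Longrightarrow> norm (case p of (\<epsilon>, \<theta>, w, t) \<Rightarrow> X \<epsilon> \<theta> w t) \<le> \<rho>"
    unfolding bounded_pos by blast
  \<comment> \<open>A pair consists of a phase \<open>\<theta>\<close> and a periodic solution close to the cycle with that phase.\<close>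
  define S where "S \<epsilon> p \<longleftrightarrow> periodic_solution T (\<lambda>t y. \<psi> y + \<epsilon> *\<^sub>R \<phi> t y \<epsilon>) (snd p) \<and>
    (\<forall>t. norm (snd p t - x0 (t + fst p)) \<le> \<epsilon> * \<rho>)" for \<epsilon> and p :: "real \<times> (real \<Rightarrow> real ^ 'n)"
  have "\<forall>\<^sub>F \<epsilon> in at_right 0. \<exists>p. S \<epsilon> p \<and> \<bar>fst p - \<theta>0\<bar> < \<delta>" if "\<delta> > 0" for \<delta>
  proof -
    have "\<forall>\<^sub>F \<epsilon> in at_right 0. \<epsilon> \<in> {0<..<min 1 (1 / \<rho>)}"
      using \<rho>(1) by (intro eventually_at_right_real) simp
    with R[OF that] show ?thesis
    proof eventually_elim
      case (elim \<epsilon>)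
      then obtain \<theta> w where \<theta>w: "\<bar>\<theta> - \<theta>0\<bar> < \<delta>" "\<bar>\<theta> - \<theta>0\<bar> \<le> 1" "norm w \<le> R" "G \<epsilon> \<theta> w = 0"
        by blast
      have \<epsilon>: "\<epsilon> \<in> {0<..1}" "\<epsilon> * \<rho> \<le> 1" and \<theta>: "\<theta> \<in> {\<theta>0 - 1..\<theta>0 + 1}"
        using elim(2) \<theta>w(2) \<rho>(1) by (auto simp: field_simps)
      define u where "u = X \<epsilon> \<theta> w"
      have u: "norm (\<epsilon> *\<^sub>R u t) \<le> \<epsilon> * \<rho>" if "t \<in> {0..T}" for t
        using \<rho>(2)[of "(\<epsilon>, \<theta>, w, t)"] that \<theta> \<theta>w(3) \<epsilon>(1) by (auto simp: u_def)
      have uT: "u T = u 0"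
        using \<theta>w(4) X0[of \<epsilon> \<theta> w] \<epsilon> \<theta> by (simp add: u_def G_def)
      define F where "F t v = \<psi> v + \<epsilon> *\<^sub>R \<phi> t v \<epsilon>" for t v
      define y where "y t = x0 t + \<epsilon> *\<^sub>R u t" for t
      obtain x where x: "periodic_solution T F x"
        "\<And>t. \<exists>s\<in>{0..T}. \<exists>k. t + \<theta> = s + of_int k * T \<and> x t = y s"
      proof (rule periodic_solution_shift[OF T])
        show "F (t + T) v = F t v" for t v
          using assms(4) \<epsilon> by (simp add: F_def)
        show "(y has_vector_derivative F (t - \<theta>) (y t)) (at t within {0..T})" if t: "t \<in> {0..T}" for t
        proof -
          have "norm (\<epsilon> *\<^sub>R X \<epsilon> \<theta> w t) \<le> 1"
            using u[OF t] \<epsilon>(2) by (simp add: u_def)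
          from X_der[OF \<epsilon>(1) \<theta> t this]
          have "(u has_vector_derivative (1 / \<epsilon>) *\<^sub>R (\<psi> (y t) - \<psi> (x0 t)) + \<phi> (t - \<theta>) (y t) \<epsilon>) (at t within {0..T})"
            by (simp add: u_def y_def \<Phi>_app)
          then have "(y has_vector_derivative \<psi> (x0 t) + \<epsilon> *\<^sub>R ((1 / \<epsilon>) *\<^sub>R (\<psi> (y t) - \<psi> (x0 t)) + \<phi> (t - \<theta>) (y t) \<epsilon>)) (at t within {0..T})"
            unfolding y_def[abs_def]
            by (intro has_vector_derivative_add has_vector_derivative_at_within[OF x0_der]
                bounded_linear.has_vector_derivative[OF bounded_linear_scaleR_right])
          then show ?thesis
            using \<epsilon>(1) by (simp add: F_def scaleR_add_right)
        qed
        show "y 0 = y T"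
          using x0_per[of 0] uT by (simp add: y_def)
      qed blast
      have "norm (x t - x0 (t + \<theta>)) \<le> \<epsilon> * \<rho>" for t
      proof -
        obtain s k where s: "s \<in> {0..T}" "t + \<theta> = s + of_int k * T" "x t = y s"
          using x(2) by blast
        have "x0 (s + of_int k * T) = x0 s"
          by (rule periodic_shift_int) (rule x0_per)
        then show ?thesis
          using u[OF s(1)] s by (simp add: y_def)
      qed
      then have "S \<epsilon> (\<theta>, x)"
        using x(1) by (simp add: S_def F_def[abs_def])
      then show ?case
        using \<theta>w(1) by (intro exI[of _ "(\<theta>, x)"]) simp
    qed
  qed
  then obtain s where s: "\<forall>\<^sub>F \<epsilon> in at_right 0. S \<epsilon> (s \<epsilon>)" "((\<lambda>\<epsilon>. \<bar>fst (s \<epsilon>) - \<theta>0\<bar>) \<longlongrightarrow> 0) (at_right 0)"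
    using eventually_at_right_selection[of "\<lambda>_ p. \<bar>fst p - \<theta>0\<bar>" S] by auto
  have phase: "((\<lambda>\<epsilon>. fst (s \<epsilon>)) \<longlongrightarrow> \<theta>0) (at_right 0)"
    using s(2) by (simp add: tendsto_rabs_zero_iff LIM_zero_iff)
  show ?thesis
  proof (intro exI[of _ "\<lambda>\<epsilon>. snd (s \<epsilon>)"] conjI ballI)
    show "\<forall>\<^sub>F \<epsilon> in at_right 0. periodic_solution T (\<lambda>t y. \<psi> y + \<epsilon> *\<^sub>R \<phi> t y \<epsilon>) (snd (s \<epsilon>))"
      using s(1) by (rule eventually_mono) (simp add: S_def)
    show "((\<lambda>\<epsilon>. snd (s \<epsilon>) t) \<longlongrightarrow> x0 (t + \<theta>0)) (at_right 0)" for t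
    proof -
      have "((\<lambda>\<epsilon>. snd (s \<epsilon>) t - x0 (t + fst (s \<epsilon>))) \<longlongrightarrow> 0) (at_right 0)"
      proof (rule Lim_null_comparison)
        show "\<forall>\<^sub>F \<epsilon> in at_right 0. norm (snd (s \<epsilon>) t - x0 (t + fst (s \<epsilon>))) \<le> \<epsilon> * \<rho>"
          using s(1) by (rule eventually_mono) (simp add: S_def)
        show "((\<lambda>\<epsilon>. \<epsilon> * \<rho>) \<longlongrightarrow> 0) (at_right 0)"
          by (auto intro!: tendsto_eq_intros)
      qed
      moreover have "((\<lambda>\<epsilon>. x0 (t + fst (s \<epsilon>))) \<longlongrightarrow> x0 (t + \<theta>0)) (at_right 0)"
        by (rule isCont_tendsto_compose[OF has_vector_derivative_continuous[OF x0_der]])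
          (intro tendsto_intros phase)
      ultimately show ?thesis
        using tendsto_add by fastforce
    qed
  qed
qed

end
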